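(* $\mathsf{Par}(\mathcal C,\mathcal S)$ is a split restriction category, with its restriction structure defined by $\overline{[s,f]_{\mathrm z^\star}}=[s,s]_{\mathrm z^\star}$ for all $\mathcal S$-spans $(s,f)$.
   Context: Standing assumptions: $\mathcal C$ is a category and $\mathcal S$ is a class of morphisms of $\mathcal C$ that contains all isomorphisms, is closed under composition, and is such that pullbacks of $\mathcal S$-morphisms along arbitrary morphisms exist in $\mathcal C$ and belong to $\mathcal S$. ($\mathcal S$ need not consist of monomorphisms.) $\mathcal S$-spans: an $\mathcal S$-span $(s,f):A\to B$ is a pair $s:D\to A$ in $\mathcal S$, $f:D\to B$ in $\mathcal C$. A (vertical) morphism $x:(s,f)\to(\tilde s,\tilde f)$ of $\mathcal S$-spans from $A$ to $B$ is a $\mathcal C$-morphism $x$ with $\tilde s\cdot x=s$, $\tilde f\cdot x=f$. Isomorphic $\mathcal S$-spans are identified. $\mathsf{Span}(\mathcal C,\mathcal S)$ is the category with the objects of $\mathcal C$ and (isomorphism classes of) $\mathcal S$-spans as morphisms, with (horizontal) composition $(t,g)\cdot(s,f)=(s\cdot t',g\cdot f')$, where $f\cdot t'=t\cdot f'$ is a pullback square. $\mathcal S$-cospans: an $\mathcal S$-cospan $\langle f,s\rangle:A\to B$ is (the isomorphism class of) a pair $f:A\to D$ in $\mathcal C$, $s:B\to D$ in $\mathcal S$. A morphism $v:\langle f,s\rangle\to\langle g,t\rangle$ is a $\mathcal C$-morphism with $v\cdot f=g$, $v\cdot s=t$. $\mathrm{pb}\langle f,s\rangle:=(s',f')$ is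 the $\mathcal S$-span given by the pullback square $f\cdot s'=s\cdot f'$. Every morphism $v:\langle f,s\rangle\to\langle g,t\rangle$ induces its conjugate $v^\star:\mathrm{pb}\langle f,s\rangle=(s',f')\to\mathrm{pb}\langle g,t\rangle=(t',g')$, the unique $\mathcal C$-morphism with $t'\cdot v^\star=s'$ and $g'\cdot v^\star=f'$. $\mathcal S^\star$ is the class of all (existing) pullbacks in $\mathcal C$ (along arbitrary morphisms) of the conjugates $v^\star$ of all $\mathcal S$-cospan morphisms $v$ with $v\in\mathcal S$. Write $(s,f)\leqslant^\star(\tilde s,\tilde f)$ iff there is a morphism $x:(s,f)\to(\tilde s,\tilde f)$ of $\mathcal S$-spans with $x\in\mathcal S^\star$. $\sim_{\mathrm z^\star}$ is the least equivalence relation containing $\leqslant^\star$; it is preserved by horizontal composition. $\mathsf{Par}(\mathcal C,\mathcal S)$ is the quotient category of $\mathsf{Span}(\mathcal C,\mathcal S)$ by $\sim_{\mathrm z^\star}$; its morphisms are the classes $[s,f]_{\mathrm z^\star}$. Restriction categories: a restriction structure on a category assigns to each morphism $f:A\to B$ a morphism $\bar f:A\to A$ such that (R1) $f\cdot\bar f=f$; (R2) $\bar f\cdot\bar g=\bar g\cdot\bar f$ whenever $\mathrm{dom}f=\mathrm{dom}g$; (R3) $\overline{g\cdot\bar f}=\bar g\cdot\bar f$ whenever $\mathrm{dom}f=\mathrm{dom}g$; (R4) $\bar g\cdot f=f\cdot\overline{g\cdot f}$ whenever $\mathrm{cod}f=\mathrm{dom}g$. A restriction category is a category with a restriction structure.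 A morphism $e$ with $\bar e=e$ is a restriction idempotent; it is split if there are $m,r$ with $m\cdot r=e$, $r\cdot m=1$. The restriction category is split if all its restriction idempotents are split. *)

theory Defs
  imports Main
begin

record ('o, 'm) precategory =
  Obj :: "'o set"
  Arr :: "'m set"
  Dom :: "'m \<Rightarrow> 'o"
  Cod :: "'m \<Rightarrow> 'o"
  Id :: "'o \<Rightarrow> 'm"
  Comp :: "'m \<Rightarrow> 'm \<Rightarrow> 'm"  (infixr "\<cdot>\<index>" 70)

definition hom :: "('o, 'm) precategory \<Rightarrow> 'o \<Rightarrow> 'o \<Rightarrow> 'm set" where
  "hom C A B = {f \<in> Arr C. Dom C f = A \<and> Cod C f = B}"

locale category =
  fixes C :: "('o, 'm) precategory" (structure)
  assumes Dom_in_Obj: "f \<in> Arr C \<Longrightarrow> Dom C f \<in> Obj C"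
    and Cod_in_Obj: "f \<in> Arr C \<Longrightarrow> Cod C f \<in> Obj C"
    and Id_in_hom: "A \<in> Obj C \<Longrightarrow> Id C A \<in> hom C A A"
    and Comp_in_hom: "f \<in> hom C A B \<Longrightarrow> g \<in> hom C B D \<Longrightarrow> g \<cdot> f \<in> hom C A D"
    and Comp_Id_right: "f \<in> hom C A B \<Longrightarrow> f \<cdot> Id C A = f"
    and Comp_Id_left: "f \<in> hom C A B \<Longrightarrow> Id C B \<cdot> f = f"
    and Comp_assoc: "f \<in> hom C A B \<Longrightarrow> g \<in> hom C B D \<Longrightarrow> h \<in> hom C D E \<Longrightarrow>
      (h \<cdot> g) \<cdot> f = h \<cdot> (g \<cdot> f)"

definition is_iso :: "('o, 'm) precategory \<Rightarrow> 'm \<Rightarrow> bool" where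
  "is_iso C f \<longleftrightarrow> f \<in> Arr C \<and>
    (\<exists>g \<in> hom C (Cod C f) (Dom C f).
      g \<cdot>\<^bsub>C\<^esub> f = Id C (Dom C f) \<and> f \<cdot>\<^bsub>C\<^esub> g = Id C (Cod C f))"

text \<open>\<open>pullback C f s s' f'\<close>: the square \<open>f \<cdot> s' = s \<cdot> f'\<close> is a pullback; thus \<open>s'\<close> is a pullback
  of \<open>s\<close> along \<open>f\<close>, and \<open>f'\<close> is a pullback of \<open>f\<close> along \<open>s\<close>.\<close>

definition pullback :: "('o, 'm) precategory \<Rightarrow> 'm \<Rightarrow> 'm \<Rightarrow> 'm \<Rightarrow> 'm \<Rightarrow> bool" where
  "pullback C f s s' f' \<longleftrightarrow>
    f \<in> Arr C \<and> s \<in> Arr C \<and> Cod C f = Cod C s \<and>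
    s' \<in> Arr C \<and> f' \<in> Arr C \<and> Dom C s' = Dom C f' \<and>
    Cod C s' = Dom C f \<and> Cod C f' = Dom C s \<and>
    f \<cdot>\<^bsub>C\<^esub> s' = s \<cdot>\<^bsub>C\<^esub> f' \<and>
    (\<forall>X. \<forall>a \<in> hom C X (Dom C f). \<forall>b \<in> hom C X (Dom C s). f \<cdot>\<^bsub>C\<^esub> a = s \<cdot>\<^bsub>C\<^esub> b \<longrightarrow>
      (\<exists>!u. u \<in> hom C X (Dom C s') \<and> s' \<cdot>\<^bsub>C\<^esub> u = a \<and> f' \<cdot>\<^bsub>C\<^esub> u = b))"

locale stable_class = category C for C :: "('o, 'm) precategory" (structure) +
  fixes S :: "'m set"
  assumes S_arrows: "S \<subseteq> Arr C"
    and S_isos: "is_iso C f \<Longrightarrow> f \<in> S"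
    and S_comp: "s \<in> S \<Longrightarrow> t \<in> S \<Longrightarrow> Cod C s = Dom C t \<Longrightarrow> t \<cdot> s \<in> S"
    and S_pullback_exists: "s \<in> S \<Longrightarrow> f \<in> Arr C \<Longrightarrow> Cod C f = Cod C s \<Longrightarrow>
      \<exists>s' f'. pullback C f s s' f'"
    and S_pullback_closed: "s \<in> S \<Longrightarrow> pullback C f s s' f' \<Longrightarrow> s' \<in> S"

text \<open>A span from \<open>A\<close> to \<open>B\<close> is a pair \<open>(s, f)\<close> with \<open>A = Cod C s\<close> and \<open>B = Cod C f\<close>.\<close>

definition spans :: "('o, 'm) precategory \<Rightarrow> 'm set \<Rightarrow> ('m \<times> 'm) set" where
  "spans C S = {(s, f). s \<in> S \<and> f \<in> Arr C \<and> Dom C s = Dom C f}"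

definition span_mor :: "('o, 'm) precategory \<Rightarrow> 'm \<Rightarrow> 'm \<times> 'm \<Rightarrow> 'm \<times> 'm \<Rightarrow> bool" where
  "span_mor C x p q \<longleftrightarrow> x \<in> hom C (Dom C (fst p)) (Dom C (fst q)) \<and>
    fst q \<cdot>\<^bsub>C\<^esub> x = fst p \<and> snd q \<cdot>\<^bsub>C\<^esub> x = snd p"

definition span_iso :: "('o, 'm) precategory \<Rightarrow> 'm set \<Rightarrow> (('m \<times> 'm) \<times> ('m \<times> 'm)) set" where
  "span_iso C S = {(p, q). p \<in> spans C S \<and> q \<in> spans C S \<and> (\<exists>x. is_iso C x \<and> span_mor C x p q)}"

definition span_class :: "('o, 'm) precategory \<Rightarrow> 'm set \<Rightarrow> 'm \<times> 'm \<Rightarrow> ('m \<times> 'm) set" where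
  "span_class C S p = span_iso C S `` {p}"

text \<open>The composite of two isomorphism classes is the union of the classes of \<open>(s \<cdot> t', g \<cdot> f')\<close> over
  all representatives and all choices of pullback; that this union is again a single class is part
  of its being a category. \<open>Dom\<close> and \<open>Cod\<close> are only meaningful on actual classes, where all
  representatives agree.\<close>

definition Span :: "('o, 'm) precategory \<Rightarrow> 'm set \<Rightarrow> ('o, ('m \<times> 'm) set) precategory" where
  "Span C S = \<lparr>
     Obj = Obj C,
     Arr = spans C S // span_iso C S,
     Dom = (\<lambda>X. the_elem ((\<lambda>(s, f). Cod C s) ` X)),
     Cod = (\<lambda>X. the_elem ((\<lambda>(s, f). Cod C f) ` X)),
     Id = (\<lambda>A. span_class C S (Id C A, Id C A)),
     Comp = (\<lambda>Y X. \<Union> {span_class C S (s \<cdot>\<^bsub>C\<^esub> t', g \<cdot>\<^bsub>C\<^esub> f') | s f t g t' f'.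
       (s, f) \<in> X \<and> (t, g) \<in> Y \<and> pullback C f t t' f'}) \<rparr>"

definition cospans :: "('o, 'm) precategory \<Rightarrow> 'm set \<Rightarrow> ('m \<times> 'm) set" where
  "cospans C S = {(f, s). f \<in> Arr C \<and> s \<in> S \<and> Cod C f = Cod C s}"

definition cospan_mor :: "('o, 'm) precategory \<Rightarrow> 'm \<Rightarrow> 'm \<times> 'm \<Rightarrow> 'm \<times> 'm \<Rightarrow> bool" where
  "cospan_mor C v p q \<longleftrightarrow> v \<in> hom C (Cod C (fst p)) (Cod C (fst q)) \<and>
    v \<cdot>\<^bsub>C\<^esub> fst p = fst q \<and> v \<cdot>\<^bsub>C\<^esub> snd p = snd q"

text \<open>Pullbacks being determined only up to isomorphism, a morphism \<open>v\<close> of cospans has one conjugate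
  \<open>k\<close> for each choice of the two pullback squares.\<close>

definition conjugate :: "('o, 'm) precategory \<Rightarrow> 'm set \<Rightarrow> 'm \<Rightarrow> 'm \<Rightarrow> bool" where
  "conjugate C S v k \<longleftrightarrow> (\<exists>f s g t s' f' t' g'.
    (f, s) \<in> cospans C S \<and> (g, t) \<in> cospans C S \<and> cospan_mor C v (f, s) (g, t) \<and>
    pullback C f s s' f' \<and> pullback C g t t' g' \<and>
    span_mor C k (s', f') (t', g'))"

definition S_star :: "('o, 'm) precategory \<Rightarrow> 'm set \<Rightarrow> 'm set" where
  "S_star C S = {y. \<exists>v k h h'. v \<in> S \<and> conjugate C S v k \<and> pullback C h k y h'}"

definition zstar_le ::
  "('o, 'm) precategory \<Rightarrow> 'm set \<Rightarrow> (('m \<times> 'm) set \<times> ('m \<times> 'm) set) set" where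
  "zstar_le C S = {(X, Y). X \<in> Arr (Span C S) \<and> Y \<in> Arr (Span C S) \<and>
    (\<exists>p \<in> X. \<exists>q \<in> Y. \<exists>x \<in> S_star C S. span_mor C x p q)}"

definition zstar_eq ::
  "('o, 'm) precategory \<Rightarrow> 'm set \<Rightarrow> (('m \<times> 'm) set \<times> ('m \<times> 'm) set) set" where
  "zstar_eq C S = \<Inter> {R. equiv (Arr (Span C S)) R \<and> zstar_le C S \<subseteq> R}"

text \<open>As for spans, composition is the union of the classes of all composites of representatives, so
  that it yields a single class precisely when the relation is compatible with composition.\<close>

definition quotient_category ::
  "('o, 'm) precategory \<Rightarrow> ('m \<times> 'm) set \<Rightarrow> ('o, 'm set) precategory" where
  "quotient_category D R = \<lparr>
     Obj = Obj D,
     Arr = Arr D // R,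
     Dom = (\<lambda>X. the_elem (Dom D ` X)),
     Cod = (\<lambda>X. the_elem (Cod D ` X)),
     Id = (\<lambda>A. R `` {Id D A}),
     Comp = (\<lambda>Y X. \<Union>g \<in> Y. \<Union>f \<in> X. R `` {g \<cdot>\<^bsub>D\<^esub> f}) \<rparr>"

definition Par :: "('o, 'm) precategory \<Rightarrow> 'm set \<Rightarrow> ('o, ('m \<times> 'm) set set) precategory" where
  "Par C S = quotient_category (Span C S) (zstar_eq C S)"

definition par_class ::
  "('o, 'm) precategory \<Rightarrow> 'm set \<Rightarrow> 'm \<Rightarrow> 'm \<Rightarrow> ('m \<times> 'm) set set" where
  "par_class C S s f = zstar_eq C S `` {span_class C S (s, f)}"

locale restriction_category = category C for C :: "('o, 'm) precategory" (structure) +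
  fixes rst :: "'m \<Rightarrow> 'm"
  assumes rst_in_hom: "f \<in> hom C A B \<Longrightarrow> rst f \<in> hom C A A"
    and R1: "f \<in> Arr C \<Longrightarrow> f \<cdot> rst f = f"
    and R2: "f \<in> Arr C \<Longrightarrow> g \<in> Arr C \<Longrightarrow> Dom C f = Dom C g \<Longrightarrow>
      rst f \<cdot> rst g = rst g \<cdot> rst f"
    and R3: "f \<in> Arr C \<Longrightarrow> g \<in> Arr C \<Longrightarrow> Dom C f = Dom C g \<Longrightarrow>
      rst (g \<cdot> rst f) = rst g \<cdot> rst f"
    and R4: "f \<in> Arr C \<Longrightarrow> g \<in> Arr C \<Longrightarrow> Cod C f = Dom C g \<Longrightarrow>
      rst g \<cdot> f = f \<cdot> rst (g \<cdot> f)"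

definition splits :: "('o, 'm) precategory \<Rightarrow> 'm \<Rightarrow> bool" where
  "splits C e \<longleftrightarrow> (\<exists>X \<in> Obj C. \<exists>m \<in> hom C X (Cod C e). \<exists>r \<in> hom C (Dom C e) X.
    m \<cdot>\<^bsub>C\<^esub> r = e \<and> r \<cdot>\<^bsub>C\<^esub> m = Id C X)"

locale split_restriction_category = restriction_category +
  assumes restriction_idempotents_split: "e \<in> Arr C \<Longrightarrow> rst e = e \<Longrightarrow> splits C e"

end

theory Submission
  imports Defs
begin

text \<open>Horizontal composition moves a span morphism \<open>x\<close> to a pullback of \<open>x\<close>, so any
  pullback-stable class of morphisms (isomorphisms, \<open>\<S>\<^sup>\<star>\<close>) induces a congruence
  on spans. The axioms (R2) and (R3) already hold for spans. For (R1), (R4) and the splitting, let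
  \<open>(a, b)\<close> be a pullback of \<open>s\<close> along \<open>s \<cdot> h\<close>, with \<open>s \<in> \<S>\<close>. The canonical
  \<open>d\<close> with \<open>a \<cdot> d = 1\<close>, \<open>b \<cdot> d = h\<close> is the conjugate of
  \<open>s : \<langle>h, 1\<rangle> \<rightarrow> \<langle>s \<cdot> h, s\<rangle>\<close>, hence lies in \<open>\<S>\<^sup>\<star>\<close> and identifies
  the two spans to be compared.\<close>

section \<open>Pullbacks in a category\<close>

text \<open>The zigzag relation is available only as a least equivalence, so an equality of classes
  is exploited through invariants: a function \<open>\<phi>\<close> on spans that is constant along
  the generating relation takes equal values on spans with equal classes. Endpoints, restriction and
  composition all descend to the quotient in this way. For the restriction it suffices that a span
  morphism from \<open>(s, f)\<close> to \<open>(t, g)\<close> is also one from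
  \<open>(s, s)\<close> to \<open>(t, t)\<close>. Composition is the delicate case, because a
  composite depends on a choice of pullback; there \<open>\<phi>\<close> collects the classes of the
  composites over all choices. Once composition is known on representatives, every law is checked by
  choosing convenient pullbacks.\<close>

lemma Collect_eqI_related:
  assumes "\<And>x y. P x y \<Longrightarrow> \<exists>x' y'. Q x' y'" "\<And>x' y'. Q x' y' \<Longrightarrow> \<exists>x y. P x y"
    and "\<And>x y x' y'. P x y \<Longrightarrow> Q x' y' \<Longrightarrow> F x y = G x' y'"
  shows "{F x y | x y. P x y} = {G x y | x y. Q x y}"
proof (intro equalityI subsetI)
  fix z assume "z \<in> {F x y | x y. P x y}"
  then show "z \<in> {G x y | x y. Q x y}" unfolding mem_Collect_eq using assms(1,3) by metis
next
  fix z assume "z \<in> {G x y | x y. Q x y}"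
  then show "z \<in> {F x y | x y. P x y}" unfolding mem_Collect_eq using assms(2,3) by metis
qed

context category
begin

section \<open>Categorical laws in terms of single arrows, and isomorphisms\<close>

lemma in_hom_iff: "f \<in> hom C A B \<longleftrightarrow> f \<in> Arr C \<and> Dom C f = A \<and> Cod C f = B"
  by (simp add: hom_def)

lemma comp_arr [simp]:
  assumes "f \<in> Arr C" "g \<in> Arr C" "Cod C f = Dom C g"
  shows "g \<cdot> f \<in> Arr C" "Dom C (g \<cdot> f) = Dom C f" "Cod C (g \<cdot> f) = Cod C g"
  using Comp_in_hom[of f "Dom C f" "Dom C g" g "Cod C g"] assms by (auto simp: in_hom_iff)

lemma Id_arr [simp]:
  assumes "A \<in> Obj C"
  shows "Id C A \<in> Arr C" "Dom C (Id C A) = A" "Cod C (Id C A) = A"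
  using Id_in_hom[OF assms] by (auto simp: in_hom_iff)

lemma Dom_Cod_Obj [simp]:
  "f \<in> Arr C \<Longrightarrow> Dom C f \<in> Obj C" "f \<in> Arr C \<Longrightarrow> Cod C f \<in> Obj C"
  by (rule Dom_in_Obj, assumption) (rule Cod_in_Obj)

lemma comp_assoc_arr:
  assumes "f \<in> Arr C" "g \<in> Arr C" "h \<in> Arr C" "Cod C f = Dom C g" "Cod C g = Dom C h"
  shows "(h \<cdot> g) \<cdot> f = h \<cdot> (g \<cdot> f)"
  using Comp_assoc[of f "Dom C f" "Dom C g" g "Dom C h" h "Cod C h"] assms
  by (auto simp: in_hom_iff)

lemma comp_Id [simp]:
  "f \<in> Arr C \<Longrightarrow> Dom C f = A \<Longrightarrow> f \<cdot> Id C A = f"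
  "f \<in> Arr C \<Longrightarrow> Cod C f = A \<Longrightarrow> Id C A \<cdot> f = f"
  using Comp_Id_right[of f A "Cod C f"] Comp_Id_left[of f "Dom C f" A] by (auto simp: in_hom_iff)

lemma iso_Id: "A \<in> Obj C \<Longrightarrow> is_iso C (Id C A)"
  unfolding is_iso_def by (auto intro!: bexI[of _ "Id C A"] simp: in_hom_iff)

lemma iso_inverse:
  assumes "is_iso C x"
  obtains y where "is_iso C y" "y \<in> Arr C" "Dom C y = Cod C x" "Cod C y = Dom C x"
    "y \<cdot> x = Id C (Dom C x)" "x \<cdot> y = Id C (Cod C x)"
proof -
  obtain y where y: "y \<in> hom C (Cod C x) (Dom C x)" "y \<cdot> x = Id C (Dom C x)"
    "x \<cdot> y = Id C (Cod C x)" and "x \<in> Arr C"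
    using assms by (auto simp: is_iso_def)
  moreover from this have "is_iso C y"
    unfolding is_iso_def by (auto simp: in_hom_iff intro!: bexI[of _ x])
  ultimately show thesis by (auto simp: in_hom_iff intro: that)
qed

lemma iso_comp:
  assumes "is_iso C x" "is_iso C y" "Cod C x = Dom C y"
  shows "is_iso C (y \<cdot> x)"
proof -
  obtain x' where x': "x' \<in> Arr C" "Dom C x' = Cod C x" "Cod C x' = Dom C x"
    "x' \<cdot> x = Id C (Dom C x)" "x \<cdot> x' = Id C (Cod C x)"
    using iso_inverse[OF assms(1)] by metis
  obtain y' where y': "y' \<in> Arr C" "Dom C y' = Cod C y" "Cod C y' = Dom C y"
    "y' \<cdot> y = Id C (Dom C y)" "y \<cdot> y' = Id C (Cod C y)"
    using iso_inverse[OF assms(2)] by metis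
  have arr: "x \<in> Arr C" "y \<in> Arr C" using assms by (auto simp: is_iso_def)
  have "(x' \<cdot> y') \<cdot> (y \<cdot> x) = x' \<cdot> ((y' \<cdot> y) \<cdot> x)"
    using arr x'(1-3) y'(1-3) assms(3) by (simp add: comp_assoc_arr)
  moreover have "(y \<cdot> x) \<cdot> (x' \<cdot> y') = y \<cdot> ((x \<cdot> x') \<cdot> y')"
    using arr x'(1-3) y'(1-3) assms(3) by (simp add: comp_assoc_arr)
  ultimately have "(x' \<cdot> y') \<cdot> (y \<cdot> x) = Id C (Dom C x)" "(y \<cdot> x) \<cdot> (x' \<cdot> y') = Id C (Cod C y)"
    using arr x' y' assms(3) by auto
  then show ?thesis
    unfolding is_iso_def using arr x' y' assms(3)
    by (intro conjI bexI[of _ "x' \<cdot> y'"]) (auto simp: in_hom_iff)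
qed

section \<open>Calculus of pullback squares\<close>

lemma pullbackD:
  assumes "pullback C f s s' f'"
  shows "f \<in> Arr C" "s \<in> Arr C" "s' \<in> Arr C" "f' \<in> Arr C" "Cod C f = Cod C s"
    "Dom C s' = Dom C f'" "Cod C s' = Dom C f" "Cod C f' = Dom C s" "f \<cdot> s' = s \<cdot> f'"
  using assms unfolding pullback_def by blast+

lemma pullback_lift:
  assumes "pullback C f s s' f'" "a \<in> Arr C" "b \<in> Arr C" "Dom C a = Dom C b"
    "Cod C a = Dom C f" "Cod C b = Dom C s" "f \<cdot> a = s \<cdot> b"
  obtains u where "u \<in> Arr C" "Dom C u = Dom C a" "Cod C u = Dom C s'" "s' \<cdot> u = a" "f' \<cdot> u = b"
proof -
  have "a \<in> hom C (Dom C a) (Dom C f)" "b \<in> hom C (Dom C a) (Dom C s)"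
    using assms by (auto simp: in_hom_iff)
  then have "\<exists>!u. u \<in> hom C (Dom C a) (Dom C s') \<and> s' \<cdot> u = a \<and> f' \<cdot> u = b"
    using assms(1,7) unfolding pullback_def by blast
  then obtain u where "u \<in> hom C (Dom C a) (Dom C s')" "s' \<cdot> u = a" "f' \<cdot> u = b"
    by blast
  then show thesis by (intro that) (auto simp: in_hom_iff)
qed

text \<open>Joint monicity of the two legs: \<open>u\<close> and \<open>v\<close> both fill the cone
  formed by \<open>s' \<cdot> v\<close> and \<open>f' \<cdot> v\<close>, and fillers are
  unique.\<close>

lemma pullback_eqI:
  assumes pb: "pullback C f s s' f'"
    and "u \<in> Arr C" "v \<in> Arr C" "Dom C u = Dom C v" "Cod C u = Dom C s'" "Cod C v = Dom C s'"
    and eq: "s' \<cdot> u = s' \<cdot> v" "f' \<cdot> u = f' \<cdot> v"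
  shows "u = v"
proof -
  note d = pullbackD[OF pb]
  have "s' \<cdot> v \<in> hom C (Dom C v) (Dom C f)" "f' \<cdot> v \<in> hom C (Dom C v) (Dom C s)"
    using assms(2-6) d by (auto simp: in_hom_iff)
  moreover have "f \<cdot> (s' \<cdot> v) = s \<cdot> (f' \<cdot> v)"
    using assms(2-6) d by (simp flip: comp_assoc_arr)
  ultimately have "\<exists>!w. w \<in> hom C (Dom C v) (Dom C s') \<and> s' \<cdot> w = s' \<cdot> v \<and> f' \<cdot> w = f' \<cdot> v"
    using pb unfolding pullback_def by blast
  moreover have "u \<in> hom C (Dom C v) (Dom C s')" "v \<in> hom C (Dom C v) (Dom C s')"
    using assms by (auto simp: in_hom_iff)
  ultimately show ?thesis using eq by blast
qed

lemma pullbackI: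
  assumes "f \<in> Arr C" "s \<in> Arr C" "s' \<in> Arr C" "f' \<in> Arr C" "Cod C f = Cod C s"
    "Dom C s' = Dom C f'" "Cod C s' = Dom C f" "Cod C f' = Dom C s" "f \<cdot> s' = s \<cdot> f'"
    and lift: "\<And>a b. a \<in> Arr C \<Longrightarrow> b \<in> Arr C \<Longrightarrow> Dom C a = Dom C b \<Longrightarrow> Cod C a = Dom C f \<Longrightarrow>
      Cod C b = Dom C s \<Longrightarrow> f \<cdot> a = s \<cdot> b \<Longrightarrow>
      \<exists>u \<in> Arr C. Dom C u = Dom C a \<and> Cod C u = Dom C s' \<and> s' \<cdot> u = a \<and> f' \<cdot> u = b"
    and uniq: "\<And>u v. u \<in> Arr C \<Longrightarrow> v \<in> Arr C \<Longrightarrow> Dom C u = Dom C v \<Longrightarrow> Cod C u = Dom C s' \<Longrightarrow>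
      Cod C v = Dom C s' \<Longrightarrow> s' \<cdot> u = s' \<cdot> v \<Longrightarrow> f' \<cdot> u = f' \<cdot> v \<Longrightarrow> u = v"
  shows "pullback C f s s' f'"
proof -
  have "\<exists>!u. u \<in> hom C X (Dom C s') \<and> s' \<cdot> u = a \<and> f' \<cdot> u = b"
    if ab: "a \<in> hom C X (Dom C f)" "b \<in> hom C X (Dom C s)" and eq: "f \<cdot> a = s \<cdot> b" for X a b
  proof -
    obtain u where u: "u \<in> hom C X (Dom C s')" "s' \<cdot> u = a" "f' \<cdot> u = b"
      using lift[OF _ _ _ _ _ eq] ab unfolding in_hom_iff by metis
    have "v = u" if "v \<in> hom C X (Dom C s')" "s' \<cdot> v = a" "f' \<cdot> v = b" for v
      using u that unfolding in_hom_iff by - (rule uniq, simp_all)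
    with u show ?thesis by blast
  qed
  then show ?thesis unfolding pullback_def using assms(1-9) by (intro conjI allI ballI impI) simp_all
qed

lemma pullback_sym:
  assumes pb: "pullback C f s s' f'"
  shows "pullback C s f f' s'"
proof (rule pullbackI)
  note d = pullbackD[OF pb]
  fix a b assume ab: "a \<in> Arr C" "b \<in> Arr C" "Dom C a = Dom C b" "Cod C a = Dom C s"
    "Cod C b = Dom C f" "s \<cdot> a = f \<cdot> b"
  obtain u where "u \<in> Arr C" "Dom C u = Dom C b" "Cod C u = Dom C s'" "s' \<cdot> u = b" "f' \<cdot> u = a"
    by (rule pullback_lift[OF pb ab(2,1) ab(3)[symmetric] ab(5,4) ab(6)[symmetric]])
  then show "\<exists>u \<in> Arr C. Dom C u = Dom C a \<and> Cod C u = Dom C f' \<and> f' \<cdot> u = a \<and> s' \<cdot> u = b"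
    using d(6) ab(3) by (intro bexI[of _ u]) simp_all
next
  fix u v assume "u \<in> Arr C" "v \<in> Arr C" "Dom C u = Dom C v" "Cod C u = Dom C f'"
    "Cod C v = Dom C f'" "f' \<cdot> u = f' \<cdot> v" "s' \<cdot> u = s' \<cdot> v"
  then show "u = v" using pullbackD(6)[OF pb] by - (rule pullback_eqI[OF pb], simp_all)
qed (use pullbackD[OF pb] in auto)

lemma pullback_Id:
  assumes "k \<in> Arr C"
  shows "pullback C (Id C (Cod C k)) k k (Id C (Dom C k))"
proof (rule pullbackI)
  fix a b assume "a \<in> Arr C" "b \<in> Arr C" "Dom C a = Dom C b" "Cod C a = Dom C (Id C (Cod C k))"
    "Cod C b = Dom C k" "Id C (Cod C k) \<cdot> a = k \<cdot> b"
  then show "\<exists>u \<in> Arr C. Dom C u = Dom C a \<and> Cod C u = Dom C k \<and> k \<cdot> u = a \<and> Id C (Dom C k) \<cdot> u = b"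
    using assms by (auto intro!: bexI[of _ b])
qed (use assms in auto)

text \<open>Pullbacks being fixed only up to isomorphism, any isomorphism can serve as both legs of
  the pullback of two identities. This freedom later exhibits isomorphisms as conjugates of
  identities.\<close>

lemma pullback_iso_square:
  assumes x: "is_iso C x"
  shows "pullback C (Id C (Cod C x)) (Id C (Cod C x)) x x"
proof -
  obtain y where y: "y \<in> Arr C" "Dom C y = Cod C x" "Cod C y = Dom C x"
    "y \<cdot> x = Id C (Dom C x)" "x \<cdot> y = Id C (Cod C x)"
    using iso_inverse[OF x] by metis
  have x_arr: "x \<in> Arr C" using x by (simp add: is_iso_def)
  show ?thesis
  proof (rule pullbackI)
    fix a b assume ab: "a \<in> Arr C" "b \<in> Arr C" "Dom C a = Dom C b"
      "Cod C a = Dom C (Id C (Cod C x))" "Cod C b = Dom C (Id C (Cod C x))"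
      "Id C (Cod C x) \<cdot> a = Id C (Cod C x) \<cdot> b"
    then have "a = b" using x_arr by simp
    moreover have "x \<cdot> (y \<cdot> a) = a" using ab x_arr y by (simp flip: comp_assoc_arr)
    ultimately show "\<exists>u \<in> Arr C. Dom C u = Dom C a \<and> Cod C u = Dom C x \<and> x \<cdot> u = a \<and> x \<cdot> u = b"
      using ab x_arr y by (intro bexI[of _ "y \<cdot> a"]) auto
  next
    fix u v assume uv: "u \<in> Arr C" "v \<in> Arr C" "Dom C u = Dom C v" "Cod C u = Dom C x"
      "Cod C v = Dom C x" "x \<cdot> u = x \<cdot> v"
    have "u = y \<cdot> (x \<cdot> u)" using uv(1-5) x_arr y by (simp flip: comp_assoc_arr)
    also have "\<dots> = y \<cdot> (x \<cdot> v)" using uv by simp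
    also have "\<dots> = v" using uv(1-5) x_arr y by (simp flip: comp_assoc_arr)
    finally show "u = v" .
  qed (use x_arr in auto)
qed

lemma pullback_paste:
  assumes pb: "pullback C f t t' f'" and pb': "pullback C f' u u' f''"
  shows "pullback C f (t \<cdot> u) (t' \<cdot> u') f''"
proof -
  note d = pullbackD[OF pb] pullbackD[OF pb']
  show ?thesis
  proof (rule pullbackI)
    have "f \<cdot> (t' \<cdot> u') = (f \<cdot> t') \<cdot> u'" using d(1-8,10-17) by (simp add: comp_assoc_arr)
    also have "\<dots> = t \<cdot> (f' \<cdot> u')" using d by (simp add: comp_assoc_arr)
    also have "\<dots> = (t \<cdot> u) \<cdot> f''" using d by (simp add: comp_assoc_arr)
    finally show "f \<cdot> (t' \<cdot> u') = (t \<cdot> u) \<cdot> f''" .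
  next
    fix a b assume ab: "a \<in> Arr C" "b \<in> Arr C" "Dom C a = Dom C b" "Cod C a = Dom C f"
      "Cod C b = Dom C (t \<cdot> u)" "f \<cdot> a = (t \<cdot> u) \<cdot> b"
    have "f \<cdot> a = t \<cdot> (u \<cdot> b)" using ab d by (simp add: comp_assoc_arr)
    then obtain w where w: "w \<in> Arr C" "Dom C w = Dom C a" "Cod C w = Dom C t'" "t' \<cdot> w = a"
      "f' \<cdot> w = u \<cdot> b"
      using pullback_lift[OF pb, of a "u \<cdot> b"] ab d by auto
    obtain z where z: "z \<in> Arr C" "Dom C z = Dom C w" "Cod C z = Dom C u'" "u' \<cdot> z = w"
      "f'' \<cdot> z = b"
      using pullback_lift[OF pb', of w b] ab d w by auto
    have "(t' \<cdot> u') \<cdot> z = a" using z w d by (simp add: comp_assoc_arr)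
    then show "\<exists>z \<in> Arr C. Dom C z = Dom C a \<and> Cod C z = Dom C (t' \<cdot> u') \<and> (t' \<cdot> u') \<cdot> z = a \<and>
        f'' \<cdot> z = b"
      using z w d by (intro bexI[of _ z]) auto
  next
    fix v w assume vw: "v \<in> Arr C" "w \<in> Arr C" "Dom C v = Dom C w" "Cod C v = Dom C (t' \<cdot> u')"
      "Cod C w = Dom C (t' \<cdot> u')" "(t' \<cdot> u') \<cdot> v = (t' \<cdot> u') \<cdot> w" "f'' \<cdot> v = f'' \<cdot> w"
    have 1: "t' \<cdot> (u' \<cdot> v) = t' \<cdot> (u' \<cdot> w)" using vw d by (simp add: comp_assoc_arr)
    have "f' \<cdot> (u' \<cdot> v) = (f' \<cdot> u') \<cdot> v" using vw(1-5) d(1-8,10-17) by (simp add: comp_assoc_arr)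
    also have "\<dots> = u \<cdot> (f'' \<cdot> v)" using vw(1-5) d by (simp add: comp_assoc_arr)
    also have "\<dots> = (u \<cdot> f'') \<cdot> w" unfolding vw(7) using vw(1-5) d(1-8,10-17) by (simp add: comp_assoc_arr)
    also have "\<dots> = f' \<cdot> (u' \<cdot> w)" unfolding d(18)[symmetric] using vw(1-5) d(1-8,10-17) by (simp add: comp_assoc_arr)
    finally have "u' \<cdot> v = u' \<cdot> w" using 1 vw d by - (rule pullback_eqI[OF pb], auto)
    then show "v = w" using vw d by - (rule pullback_eqI[OF pb'], auto)
  qed (use d in auto)
qed

text \<open>The cancellation half of the pasting law: a cone on the small square extends along
  \<open>g'\<close> to a cone on the outer rectangle, and the filler of the latter also fills the
  former because \<open>t''\<close> and \<open>g'\<close> are jointly monic.\<close>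

lemma pullback_cancel:
  assumes left: "pullback C (g \<cdot> x) t t' f'" and pb: "pullback C g t t'' g'"
    and x: "x \<in> Arr C" "Cod C x = Dom C g"
    and x': "x' \<in> Arr C" "Dom C x' = Dom C t'" "Cod C x' = Dom C t''"
    and eq: "t'' \<cdot> x' = x \<cdot> t'" "g' \<cdot> x' = f'"
  shows "pullback C x t'' t' x'"
proof -
  note d = pullbackD[OF left] pullbackD[OF pb]
  show ?thesis
  proof (rule pullbackI)
    fix a b assume ab: "a \<in> Arr C" "b \<in> Arr C" "Dom C a = Dom C b" "Cod C a = Dom C x"
      "Cod C b = Dom C t''" "x \<cdot> a = t'' \<cdot> b"
    have "(g \<cdot> x) \<cdot> a = g \<cdot> (t'' \<cdot> b)" using ab x d by (simp add: comp_assoc_arr)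
    also have "\<dots> = (g \<cdot> t'') \<cdot> b" using ab x d(1-8,10-17) by (simp add: comp_assoc_arr)
    also have "\<dots> = t \<cdot> (g' \<cdot> b)" using ab x d by (simp add: comp_assoc_arr)
    finally obtain w where w: "w \<in> Arr C" "Dom C w = Dom C a" "Cod C w = Dom C t'" "t' \<cdot> w = a"
      "f' \<cdot> w = g' \<cdot> b"
      using pullback_lift[OF left, of a "g' \<cdot> b"] ab x d by auto
    have "t'' \<cdot> (x' \<cdot> w) = (t'' \<cdot> x') \<cdot> w" using w(1-3) x' d(3,12,15) by (simp add: comp_assoc_arr)
    also have "\<dots> = x \<cdot> (t' \<cdot> w)" unfolding eq(1) using w(1-3) x d(1-8,10) by (simp add: comp_assoc_arr)
    also have "\<dots> = t'' \<cdot> b" using w ab by simp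
    finally have 1: "t'' \<cdot> (x' \<cdot> w) = t'' \<cdot> b" .
    have "g' \<cdot> (x' \<cdot> w) = (g' \<cdot> x') \<cdot> w" using w(1-3) x' d(13,15) by (simp add: comp_assoc_arr)
    with w eq have "g' \<cdot> (x' \<cdot> w) = g' \<cdot> b" by simp
    with 1 have "x' \<cdot> w = b" using w ab x' d by - (rule pullback_eqI[OF pb], auto)
    with w show "\<exists>w \<in> Arr C. Dom C w = Dom C a \<and> Cod C w = Dom C t' \<and> t' \<cdot> w = a \<and> x' \<cdot> w = b"
      by auto
  next
    fix v w assume vw: "v \<in> Arr C" "w \<in> Arr C" "Dom C v = Dom C w" "Cod C v = Dom C t'"
      "Cod C w = Dom C t'" "t' \<cdot> v = t' \<cdot> w" "x' \<cdot> v = x' \<cdot> w"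
    have "f' \<cdot> v = g' \<cdot> (x' \<cdot> v)"
      unfolding eq(2)[symmetric] using vw(1-5) x' d(13,15) by (simp add: comp_assoc_arr)
    also have "\<dots> = f' \<cdot> w"
      unfolding eq(2)[symmetric] vw(7) using vw(1-5) x' d(13,15) by (simp add: comp_assoc_arr)
    finally show "v = w" using vw d by - (rule pullback_eqI[OF left], auto)
  qed (use d x x' eq in auto)
qed

text \<open>With \<open>l\<close> inverse to \<open>k\<close>, the inverse of \<open>y\<close> is
  the filler \<open>u\<close> of the cone made of an identity and
  \<open>l \<cdot> h\<close>.\<close>

lemma pullback_iso:
  assumes "is_iso C k" and pb: "pullback C h k y h'"
  shows "is_iso C y"
proof -
  note d = pullbackD[OF pb]
  obtain l where l: "l \<in> Arr C" "Dom C l = Cod C k" "Cod C l = Dom C k"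
    "l \<cdot> k = Id C (Dom C k)" "k \<cdot> l = Id C (Cod C k)"
    using iso_inverse[OF assms(1)] by metis
  have "k \<cdot> (l \<cdot> h) = h" using l d by (simp flip: comp_assoc_arr)
  then obtain u where u: "u \<in> Arr C" "Dom C u = Dom C h" "Cod C u = Dom C y"
    "y \<cdot> u = Id C (Dom C h)" "h' \<cdot> u = l \<cdot> h"
    using pullback_lift[OF pb, of "Id C (Dom C h)" "l \<cdot> h"] l d by auto
  have "u \<cdot> y = Id C (Dom C y)"
  proof (rule pullback_eqI[OF pb])
    show "y \<cdot> (u \<cdot> y) = y \<cdot> Id C (Dom C y)" using u d by (simp flip: comp_assoc_arr)
    have "h' \<cdot> (u \<cdot> y) = (l \<cdot> h) \<cdot> y" unfolding u(5)[symmetric] using u(1-3) d(1-8) by (simp add: comp_assoc_arr)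
    also have "\<dots> = l \<cdot> (k \<cdot> h')" using l(1-3) d by (simp add: comp_assoc_arr)
    also have "\<dots> = h' \<cdot> Id C (Dom C y)" using l d(1-8) by (simp flip: comp_assoc_arr)
    finally show "h' \<cdot> (u \<cdot> y) = h' \<cdot> Id C (Dom C y)" .
  qed (use u d in auto)
  then show ?thesis unfolding is_iso_def using u d by (auto simp: in_hom_iff intro!: bexI[of _ u])
qed

section \<open>Horizontal composition and morphisms of spans\<close>

text \<open>As \<open>f = f1 \<cdot> x\<close>, the pullback over \<open>f\<close> is an outer
  rectangle whose one half is the pullback over \<open>f1\<close>; cancellation makes the remaining
  square over \<open>x\<close> a pullback. Its side \<open>x'\<close> is the comparison of the
  composites.\<close>

lemma span_mor_comp_right:
  assumes x: "span_mor C x (s, f) (s1, f1)" and "s1 \<in> Arr C" "f1 \<in> Arr C" "g \<in> Arr C"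
    and "Dom C s1 = Dom C f1" "Dom C s = Dom C f" "Dom C g = Dom C t"
    and pb: "pullback C f t t' f'" and pb1: "pullback C f1 t t1 f1'"
  obtains x' where "pullback C t1 x x' t'" "span_mor C x' (s \<cdot> t', g \<cdot> f') (s1 \<cdot> t1, g \<cdot> f1')"
proof -
  note d = pullbackD[OF pb] pullbackD[OF pb1]
  have xx: "x \<in> Arr C" "Dom C x = Dom C f" "Cod C x = Dom C f1" "s1 \<cdot> x = s" "f1 \<cdot> x = f"
    using x assms by (auto simp: span_mor_def in_hom_iff)
  have "f1 \<cdot> (x \<cdot> t') = (f1 \<cdot> x) \<cdot> t'" using xx(1-3) d(1-8,10-17) by (simp add: comp_assoc_arr)
  also have "\<dots> = t \<cdot> f'" using xx d by simp
  finally have eq: "f1 \<cdot> (x \<cdot> t') = t \<cdot> f'" .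
  have xt: "x \<cdot> t' \<in> Arr C" "Dom C (x \<cdot> t') = Dom C f'" "Cod C (x \<cdot> t') = Dom C f1"
    using xx(1-3) d(1-8) by simp_all
  obtain x' where x': "x' \<in> Arr C" "Dom C x' = Dom C (x \<cdot> t')" "Cod C x' = Dom C t1"
    "t1 \<cdot> x' = x \<cdot> t'" "f1' \<cdot> x' = f'"
    using pullback_lift[OF pb1 xt(1) d(4) xt(2,3) d(8) eq] .
  have dom: "Dom C x' = Dom C t'" using x'(2) xt(2) d(6) by simp
  show thesis
  proof
    have "pullback C (f1 \<cdot> x) t t' f'" using pb xx(5) by simp
    then have "pullback C x t1 t' x'"
      by (rule pullback_cancel[OF _ pb1 xx(1,3) x'(1) dom x'(3-5)])
    then show "pullback C t1 x x' t'" by (rule pullback_sym)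
    have "(s1 \<cdot> t1) \<cdot> x' = s1 \<cdot> (x \<cdot> t')"
      unfolding x'(4)[symmetric] using assms(2-7) x'(1,3) d(10-17) by (simp add: comp_assoc_arr)
    also have "\<dots> = s \<cdot> t'"
      unfolding xx(4)[symmetric] using assms(2-7) xx(1-3) d(1-8) by (simp add: comp_assoc_arr)
    finally have 1: "(s1 \<cdot> t1) \<cdot> x' = s \<cdot> t'" .
    have 2: "(g \<cdot> f1') \<cdot> x' = g \<cdot> f'"
      unfolding x'(5)[symmetric] using assms(2-7) x'(1,3) d(1-8,10-17) by (simp add: comp_assoc_arr)
    have s: "s \<in> Arr C" unfolding xx(4)[symmetric] using xx(1,3) assms(2,5) by simp
    show "span_mor C x' (s \<cdot> t', g \<cdot> f') (s1 \<cdot> t1, g \<cdot> f1')"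
      using 1 2 s dom x'(1,3) d assms(2,5-7) by (simp add: span_mor_def in_hom_iff)
  qed
qed

text \<open>Reversing spans exchanges the two sides of composition: with legs and pullback sides
  swapped, this becomes \<open>span_mor_comp_right\<close>, which treats both legs as arbitrary
  arrows.\<close>

lemma span_mor_comp_left:
  assumes y: "span_mor C y (t, g) (t1, g1)" and "t1 \<in> Arr C" "g1 \<in> Arr C" "s \<in> Arr C"
    and "Dom C t1 = Dom C g1" "Dom C t = Dom C g" "Dom C s = Dom C f"
    and pb: "pullback C f t t' f'" and pb1: "pullback C f t1 t1' f1"
  obtains y' where "pullback C f1 y y' f'" "span_mor C y' (s \<cdot> t', g \<cdot> f') (s \<cdot> t1', g1 \<cdot> f1)"
proof -
  have "span_mor C y (g, t) (g1, t1)" using y assms(5,6) by (simp add: span_mor_def)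
  then obtain y' where y': "pullback C f1 y y' f'" "span_mor C y' (g \<cdot> f', s \<cdot> t') (g1 \<cdot> f1, s \<cdot> t1')"
    by (rule span_mor_comp_right[where g = s,
          OF _ _ _ _ _ _ _ pullback_sym[OF pb] pullback_sym[OF pb1]])
      (use assms in auto)
  have "y \<in> Arr C" "Cod C y = Dom C g1" "g1 \<cdot> y = g"
    using y assms(5) by (simp_all add: span_mor_def in_hom_iff)
  then have "g \<in> Arr C" using assms(3) comp_arr(1) by metis
  note d = this pullbackD(1-8)[OF pb] pullbackD(1-8)[OF pb1]
  have "span_mor C y' (s \<cdot> t', g \<cdot> f') (s \<cdot> t1', g1 \<cdot> f1)"
    using y'(2) d assms(2-7) by (simp add: span_mor_def)
  with y'(1) show thesis by (rule that)
qed

end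

section \<open>The class of pullbacks of conjugates\<close>

context stable_class
begin

lemma S_arr: "s \<in> S \<Longrightarrow> s \<in> Arr C"
  using S_arrows by auto

lemma Id_in_S: "A \<in> Obj C \<Longrightarrow> Id C A \<in> S"
  by (intro S_isos iso_Id)

text \<open>Every arrow is its own pullback along an identity.\<close>

lemma conjugate_in_S_star:
  assumes "v \<in> S" "conjugate C S v k"
  shows "k \<in> S_star C S"
proof -
  have "k \<in> Arr C" using assms(2) by (auto simp: conjugate_def span_mor_def in_hom_iff)
  from pullback_Id[OF this] show ?thesis using assms by (auto simp: S_star_def)
qed

text \<open>A pullback of a pullback of the conjugate \<open>k\<close> is again a pullback of
  \<open>k\<close>, by pasting. This stability is what makes the zigzag relation compatible with
  composition.\<close>

lemma S_star_pullback:
  assumes "y \<in> S_star C S" and pb: "pullback C h y z h'"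
  shows "z \<in> S_star C S"
proof -
  obtain v k i i' where v: "v \<in> S" "conjugate C S v k" "pullback C i k y i'"
    using assms by (auto simp: S_star_def)
  have "pullback C k (i \<cdot> h) (i' \<cdot> h') z"
    using pullback_paste[OF pullback_sym[OF v(3)] pullback_sym[OF pb]] .
  from pullback_sym[OF this] show ?thesis using v by (auto simp: S_star_def)
qed

text \<open>For the cospan of two identities, \<open>x\<close> is a legitimate choice of both
  pullback legs; its comparison with the identity legs is \<open>x\<close> itself, a conjugate of an
  identity.\<close>

lemma iso_in_S_star:
  assumes "is_iso C x"
  shows "x \<in> S_star C S"
proof (rule conjugate_in_S_star)
  have x: "x \<in> Arr C" using assms by (simp add: is_iso_def)
  let ?i = "Id C (Cod C x)"
  show "?i \<in> S" using x by (simp add: Id_in_S)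
  have "(?i, ?i) \<in> cospans C S" using x by (simp add: cospans_def Id_in_S)
  moreover have "cospan_mor C ?i (?i, ?i) (?i, ?i)" using x by (simp add: cospan_mor_def in_hom_iff)
  moreover have "pullback C ?i ?i x x" "pullback C ?i ?i ?i ?i"
    using pullback_iso_square[OF assms] pullback_iso_square[OF iso_Id, of "Cod C x"] x by auto
  moreover have "span_mor C x (x, x) (?i, ?i)" using x by (simp add: span_mor_def in_hom_iff)
  ultimately show "conjugate C S ?i x" unfolding conjugate_def by blast
qed

lemma section_in_S_star:
  assumes s: "s \<in> S" and h: "h \<in> Arr C" "Cod C h = Dom C s"
    and pb: "pullback C (s \<cdot> h) s a b"
  obtains d where "d \<in> S_star C S" "d \<in> Arr C" "Dom C d = Dom C h" "Cod C d = Dom C a"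
    "a \<cdot> d = Id C (Dom C h)" "b \<cdot> d = h"
proof -
  note d = pullbackD[OF pb]
  have "(s \<cdot> h) \<cdot> Id C (Dom C h) = s \<cdot> h" using h d by simp
  then obtain k where k: "k \<in> Arr C" "Dom C k = Dom C h" "Cod C k = Dom C a"
    "a \<cdot> k = Id C (Dom C h)" "b \<cdot> k = h"
    using pullback_lift[OF pb, of "Id C (Dom C h)" h] h d by auto
  let ?i = "Id C (Dom C s)"
  have "(h, ?i) \<in> cospans C S" "(s \<cdot> h, s) \<in> cospans C S"
    using h d s by (auto simp: cospans_def Id_in_S)
  moreover have "cospan_mor C s (h, ?i) (s \<cdot> h, s)"
    using h d by (simp add: cospan_mor_def in_hom_iff)
  \<comment> \<open>With this choice of pullback of \<open>h\<close> and an identity, the two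
    equations for \<open>k\<close> say that it is a span morphism into
    \<open>(a, b)\<close>.\<close>
  moreover have "pullback C h ?i (Id C (Dom C h)) h"
    using pullback_sym[OF pullback_Id[OF h(1)]] h by simp
  moreover have "span_mor C k (Id C (Dom C h), h) (a, b)"
    using h k by (simp add: span_mor_def in_hom_iff)
  ultimately have "conjugate C S s k" unfolding conjugate_def using pb by blast
  then show thesis using that k conjugate_in_S_star[OF s] by blast
qed

section \<open>Composition of span classes\<close>

lemma spans_iff: "(s, f) \<in> spans C S \<longleftrightarrow> s \<in> S \<and> f \<in> Arr C \<and> Dom C s = Dom C f"
  by (simp add: spans_def)

lemma pullback_of_span:
  assumes "(t, g) \<in> spans C S" "f \<in> Arr C" "Cod C f = Cod C t"
  obtains t' f' where "pullback C f t t' f'"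
  using S_pullback_exists[of t f] assms by (auto simp: spans_iff)

lemma comp_span_in_spans:
  assumes "(s, f) \<in> spans C S" "(t, g) \<in> spans C S" and pb: "pullback C f t t' f'"
  shows "(s \<cdot> t', g \<cdot> f') \<in> spans C S"
proof -
  note d = pullbackD[OF pb]
  have "t' \<in> S" using S_pullback_closed[OF _ pb] assms by (simp add: spans_iff)
  then have "s \<cdot> t' \<in> S" using assms d by (intro S_comp) (auto simp: spans_iff)
  then show ?thesis using assms d S_arr by (auto simp: spans_iff)
qed

lemma equiv_span_iso: "equiv (spans C S) (span_iso C S)"
proof (rule equivI)
  show "span_iso C S \<subseteq> spans C S \<times> spans C S" by (auto simp: span_iso_def)
  show "refl_on (spans C S) (span_iso C S)"
  proof (rule refl_onI)
    fix p assume p: "p \<in> spans C S"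
    then have "span_mor C (Id C (Dom C (fst p))) p p" "is_iso C (Id C (Dom C (fst p)))"
      using S_arr by (cases p; auto simp: span_mor_def in_hom_iff spans_iff intro: iso_Id)+
    then show "(p, p) \<in> span_iso C S" using p by (auto simp: span_iso_def)
  qed
  show "sym (span_iso C S)"
  proof (rule symI)
    fix p q assume "(p, q) \<in> span_iso C S"
    then obtain x where x: "p \<in> spans C S" "q \<in> spans C S" "is_iso C x" "span_mor C x p q"
      by (auto simp: span_iso_def)
    obtain s f t g where pq: "p = (s, f)" "q = (t, g)" by (cases p, cases q)
    obtain y where y: "is_iso C y" "y \<in> Arr C" "Dom C y = Cod C x" "Cod C y = Dom C x"
      "x \<cdot> y = Id C (Cod C x)"
      using iso_inverse[OF x(3)] by metis
    have a: "x \<in> Arr C" "Dom C x = Dom C f" "Cod C x = Dom C g" "t \<cdot> x = s" "g \<cdot> x = f"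
      "t \<in> Arr C" "g \<in> Arr C" "Dom C t = Dom C g" "Dom C s = Dom C f"
      using x S_arr by (simp_all add: pq span_mor_def in_hom_iff spans_iff)
    have "s \<cdot> y = t" using y a(1-3,6-9) by (simp add: comp_assoc_arr flip: a(4))
    moreover have "f \<cdot> y = g" using y a(1,3,6-9) by (simp add: comp_assoc_arr flip: a(5))
    ultimately have "span_mor C y q p" using y a by (simp add: pq span_mor_def in_hom_iff)
    then show "(q, p) \<in> span_iso C S" using x y by (auto simp: span_iso_def)
  qed
  show "trans (span_iso C S)"
  proof (rule transI)
    fix p q r assume "(p, q) \<in> span_iso C S" "(q, r) \<in> span_iso C S"
    then obtain x y where x: "p \<in> spans C S" "q \<in> spans C S" "is_iso C x" "span_mor C x p q"
      and y: "r \<in> spans C S" "is_iso C y" "span_mor C y q r"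
      by (auto simp: span_iso_def)
    obtain s f t g u h where pq: "p = (s, f)" "q = (t, g)" "r = (u, h)"
      by (cases p, cases q, cases r)
    have a: "x \<in> Arr C" "y \<in> Arr C" "Dom C x = Dom C s" "Cod C x = Dom C t" "Dom C y = Dom C t"
      "Cod C y = Dom C u" "t \<cdot> x = s" "g \<cdot> x = f" "u \<cdot> y = t" "h \<cdot> y = g"
      "u \<in> Arr C" "h \<in> Arr C" "Dom C h = Dom C u"
      using x y S_arr by (simp_all add: pq span_mor_def in_hom_iff spans_iff)
    have "u \<cdot> (y \<cdot> x) = (u \<cdot> y) \<cdot> x" "h \<cdot> (y \<cdot> x) = (h \<cdot> y) \<cdot> x"
      using a(1-6,11-13) by (simp_all add: comp_assoc_arr)
    then have "span_mor C (y \<cdot> x) p r" using a by (simp add: pq span_mor_def in_hom_iff)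
    moreover have "is_iso C (y \<cdot> x)" using x y a by (intro iso_comp) simp_all
    ultimately show "(p, r) \<in> span_iso C S" using x y by (auto simp: span_iso_def)
  qed
qed

lemma mem_span_class_iff: "q \<in> span_class C S p \<longleftrightarrow> (p, q) \<in> span_iso C S"
  by (simp add: span_class_def)

lemma self_in_span_class: "p \<in> spans C S \<Longrightarrow> p \<in> span_class C S p"
  using equiv_class_self[OF equiv_span_iso] by (simp add: span_class_def)

lemma span_class_absorb: "q \<in> span_class C S p \<Longrightarrow> span_class C S q = span_class C S p"
  unfolding span_class_def by (rule equiv_class_eq[OF equiv_span_iso, symmetric]) simp

lemma Arr_Span: "Arr (Span C S) = span_class C S ` spans C S"
  by (auto simp: Span_def quotient_def span_class_def)

lemma span_mor_Cod:
  assumes "span_mor C x p q" "q \<in> spans C S"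
  shows "Cod C (fst p) = Cod C (fst q)" "Cod C (snd p) = Cod C (snd q)"
proof -
  obtain t g where q: "q = (t, g)" by (cases q)
  have a: "x \<in> Arr C" "Cod C x = Dom C t" "fst p = t \<cdot> x" "snd p = g \<cdot> x"
    "t \<in> Arr C" "g \<in> Arr C" "Dom C g = Dom C t"
    using assms S_arr by (simp_all add: q span_mor_def in_hom_iff spans_iff)
  show "Cod C (fst p) = Cod C (fst q)" "Cod C (snd p) = Cod C (snd q)"
    unfolding a(3,4) using a(1,2,5-7) by (simp_all add: q)
qed

lemma span_class_Cod:
  assumes "q \<in> span_class C S p"
  shows "Cod C (fst q) = Cod C (fst p)" "Cod C (snd q) = Cod C (snd p)"
proof -
  obtain x where "q \<in> spans C S" "span_mor C x p q"
    using assms by (auto simp: mem_span_class_iff span_iso_def)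
  then show "Cod C (fst q) = Cod C (fst p)" "Cod C (snd q) = Cod C (snd p)"
    using span_mor_Cod[of x p q] by simp_all
qed

text \<open>All representatives of a class agree on the codomain of the first leg, so
  \<open>the_elem\<close> is applied to a singleton.\<close>

lemma Dom_Span:
  assumes "(s, f) \<in> spans C S"
  shows "Dom (Span C S) (span_class C S (s, f)) = Cod C s"
proof -
  have "(\<lambda>(s, f). Cod C s) ` span_class C S (s, f) = (\<lambda>_. Cod C s) ` span_class C S (s, f)"
    by (rule image_cong[OF refl]) (use span_class_Cod(1)[of _ "(s, f)"] in \<open>simp add: split_beta\<close>)
  also have "\<dots> = {Cod C s}" by (rule image_constant[OF self_in_span_class[OF assms]])
  finally show ?thesis by (simp add: Span_def)
qed

lemma Cod_Span:
  assumes "(s, f) \<in> spans C S"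
  shows "Cod (Span C S) (span_class C S (s, f)) = Cod C f"
proof -
  have "(\<lambda>(s, f). Cod C f) ` span_class C S (s, f) = (\<lambda>_. Cod C f) ` span_class C S (s, f)"
    by (rule image_cong[OF refl]) (use span_class_Cod(2)[of _ "(s, f)"] in \<open>simp add: split_beta\<close>)
  also have "\<dots> = {Cod C f}" by (rule image_constant[OF self_in_span_class[OF assms]])
  finally show ?thesis by (simp add: Span_def)
qed

lemma comp_span_iso:
  assumes p: "((s, f), (s1, f1)) \<in> span_iso C S" and q: "((t, g), (t1, g1)) \<in> span_iso C S"
    and pb: "pullback C f t t' f'" and pb1: "pullback C f1 t1 t1' f1'"
  shows "((s \<cdot> t', g \<cdot> f'), (s1 \<cdot> t1', g1 \<cdot> f1')) \<in> span_iso C S"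
proof -
  obtain x y where x: "is_iso C x" "span_mor C x (s, f) (s1, f1)"
    and y: "is_iso C y" "span_mor C y (t, g) (t1, g1)"
    using p q by (auto simp: span_iso_def)
  have sp: "(s, f) \<in> spans C S" "(s1, f1) \<in> spans C S" "(t, g) \<in> spans C S" "(t1, g1) \<in> spans C S"
    using p q by (auto simp: span_iso_def)
  note d = pullbackD[OF pb] pullbackD[OF pb1]
  have "Cod C f1 = Cod C t"
    using d span_mor_Cod(2)[OF x(2)] sp by simp
  \<comment> \<open>The composite of the new first span with the old second one is the halfway
    point. One factor changes at a time, and each comparison is a pullback of an
    isomorphism.\<close>
  then obtain t2 f2 where pb2: "pullback C f1 t t2 f2"
    by (rule pullback_of_span[OF sp(3) d(10)])
  obtain x' where x': "pullback C t2 x x' t'" "span_mor C x' (s \<cdot> t', g \<cdot> f') (s1 \<cdot> t2, g \<cdot> f2)"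
    by (rule span_mor_comp_right[OF x(2) _ _ _ _ _ _ pb pb2, of g])
      (use sp S_arr in \<open>auto simp: spans_iff\<close>)
  obtain y' where y': "pullback C f1' y y' f2" "span_mor C y' (s1 \<cdot> t2, g \<cdot> f2) (s1 \<cdot> t1', g1 \<cdot> f1')"
    by (rule span_mor_comp_left[OF y(2) _ _ _ _ _ _ pb2 pb1, of s1])
      (use sp S_arr in \<open>auto simp: spans_iff\<close>)
  have "((s \<cdot> t', g \<cdot> f'), (s1 \<cdot> t2, g \<cdot> f2)) \<in> span_iso C S"
    using x' pullback_iso[OF x(1)] sp pb pb2 by (auto simp: span_iso_def comp_span_in_spans)
  moreover have "((s1 \<cdot> t2, g \<cdot> f2), (s1 \<cdot> t1', g1 \<cdot> f1')) \<in> span_iso C S"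
    using y' pullback_iso[OF y(1)] sp pb1 pb2 by (auto simp: span_iso_def comp_span_in_spans)
  ultimately show ?thesis
    using equiv_span_iso by (meson equivE transD)
qed

text \<open>By \<open>comp_span_iso\<close> all members of the united family coincide, even those
  coming from different pullbacks of the same representatives, so the union runs over a single
  class.\<close>

lemma Comp_Span:
  assumes p: "(s, f) \<in> spans C S" and q: "(t, g) \<in> spans C S" and pb: "pullback C f t t' f'"
  shows "Comp (Span C S) (span_class C S (t, g)) (span_class C S (s, f)) =
    span_class C S (s \<cdot> t', g \<cdot> f')"
proof -
  have eq: "span_class C S (s1 \<cdot> t1', g1 \<cdot> f1') = span_class C S (s \<cdot> t', g \<cdot> f')"
    if "(s1, f1) \<in> span_class C S (s, f)" "(t1, g1) \<in> span_class C S (t, g)"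
      "pullback C f1 t1 t1' f1'" for s1 f1 t1 g1 t1' f1'
    using comp_span_iso[OF _ _ pb that(3)] that(1,2)
    by (intro span_class_absorb) (simp add: mem_span_class_iff)
  let ?M = "{span_class C S (s1 \<cdot> t1', g1 \<cdot> f1') | s1 f1 t1 g1 t1' f1'.
    (s1, f1) \<in> span_class C S (s, f) \<and> (t1, g1) \<in> span_class C S (t, g) \<and>
    pullback C f1 t1 t1' f1'}"
  have "span_class C S (s \<cdot> t', g \<cdot> f') \<in> ?M"
    using self_in_span_class[OF p] self_in_span_class[OF q] pb by blast
  moreover have "?M \<subseteq> {span_class C S (s \<cdot> t', g \<cdot> f')}" using eq by blast
  ultimately have "?M = {span_class C S (s \<cdot> t', g \<cdot> f')}" by blast
  then show ?thesis unfolding Span_def by simp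
qed

section \<open>The quotient by zigzags\<close>

text \<open>The generating relation on pairs instead of isomorphism classes, so that morphisms and
  pullbacks can be handled on explicit legs. It also contains isomorphism of spans.\<close>

definition span_le :: "'m \<times> 'm \<Rightarrow> 'm \<times> 'm \<Rightarrow> bool" where
  "span_le p q \<longleftrightarrow> p \<in> spans C S \<and> q \<in> spans C S \<and> (\<exists>x \<in> S_star C S. span_mor C x p q)"

lemma span_iso_imp_span_le: "(p, q) \<in> span_iso C S \<Longrightarrow> span_le p q"
  using iso_in_S_star by (auto simp: span_iso_def span_le_def)

lemma span_le_refl: "p \<in> spans C S \<Longrightarrow> span_le p p"
  using self_in_span_class span_iso_imp_span_le by (simp add: mem_span_class_iff)

lemma zstar_le_subset: "zstar_le C S \<subseteq> Arr (Span C S) \<times> Arr (Span C S)"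
  by (auto simp: zstar_le_def)

lemma zstar_eq_least: "equiv (Arr (Span C S)) R \<Longrightarrow> zstar_le C S \<subseteq> R \<Longrightarrow> zstar_eq C S \<subseteq> R"
  unfolding zstar_eq_def by blast

lemma zstar_le_imp_eq: "zstar_le C S \<subseteq> zstar_eq C S"
  unfolding zstar_eq_def by blast

lemma equiv_zstar_eq: "equiv (Arr (Span C S)) (zstar_eq C S)"
proof (rule equivI)
  \<comment> \<open>The full relation is one of those intersected, which keeps the intersection
    inside the set of arrows.\<close>
  have "equiv (Arr (Span C S)) (Arr (Span C S) \<times> Arr (Span C S))"
    by (intro equivI) (auto simp: refl_on_def sym_def trans_def)
  from zstar_eq_least[OF this zstar_le_subset]
  show "zstar_eq C S \<subseteq> Arr (Span C S) \<times> Arr (Span C S)" .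
  show "refl_on (Arr (Span C S)) (zstar_eq C S)"
    unfolding zstar_eq_def refl_on_def by (auto elim!: equivE dest: refl_onD)
  show "sym (zstar_eq C S)"
    unfolding zstar_eq_def by (rule symI) (blast elim: equivE dest: symD)
  show "trans (zstar_eq C S)"
    unfolding zstar_eq_def by (rule transI) (blast elim: equivE dest: transD)
qed

lemma par_class_eq_iff:
  assumes "(s, f) \<in> spans C S" "(t, g) \<in> spans C S"
  shows "par_class C S s f = par_class C S t g \<longleftrightarrow>
    (span_class C S (s, f), span_class C S (t, g)) \<in> zstar_eq C S"
  unfolding par_class_def using assms
  by (intro eq_equiv_class_iff[OF equiv_zstar_eq]) (auto simp: Arr_Span)

lemma par_class_eqI:
  assumes "span_le (s, f) (t, g)"
  shows "par_class C S s f = par_class C S t g"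
proof -
  have sp: "(s, f) \<in> spans C S" "(t, g) \<in> spans C S" using assms by (auto simp: span_le_def)
  then have "(span_class C S (s, f), span_class C S (t, g)) \<in> zstar_le C S"
    using assms self_in_span_class unfolding zstar_le_def span_le_def Arr_Span by blast
  then show ?thesis using zstar_le_imp_eq by (auto simp: par_class_eq_iff[OF sp])
qed

text \<open>This replaces induction along zigzags. The relation \<open>R\<close>, by which
  \<open>\<phi>\<close> agrees on all representatives of two classes, is an equivalence containing
  the generators, hence contains the least such equivalence.\<close>

lemma par_class_invariant:
  assumes inv: "\<And>p q. span_le p q \<Longrightarrow> \<phi> p = \<phi> q"
    and sp: "(s, f) \<in> spans C S" "(t, g) \<in> spans C S"
    and eq: "par_class C S s f = par_class C S t g"
  shows "\<phi> (s, f) = \<phi> (t, g)"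
proof -
  let ?A = "Arr (Span C S)"
  define R where "R = {(X, Y). X \<in> ?A \<and> Y \<in> ?A \<and> (\<forall>p \<in> X. \<forall>q \<in> Y. \<phi> p = \<phi> q)}"
  \<comment> \<open>Isomorphisms lie in \<open>S_star\<close>, so constancy along
    \<open>span_le\<close> includes constancy on isomorphism classes.\<close>
  have const: "\<phi> p = \<phi> r" if "p \<in> span_class C S r" for p r
    using inv[of r p] span_iso_imp_span_le that by (simp add: mem_span_class_iff)
  have R_iff: "(span_class C S p, span_class C S q) \<in> R \<longleftrightarrow> \<phi> p = \<phi> q"
    if "p \<in> spans C S" "q \<in> spans C S" for p q
  proof
    assume "(span_class C S p, span_class C S q) \<in> R"
    then show "\<phi> p = \<phi> q" using that self_in_span_class unfolding R_def by blast
  next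
    assume "\<phi> p = \<phi> q"
    then have "\<phi> p' = \<phi> q'" if "p' \<in> span_class C S p" "q' \<in> span_class C S q" for p' q'
      using const[OF that(1)] const[OF that(2)] by simp
    then show "(span_class C S p, span_class C S q) \<in> R" using that unfolding R_def Arr_Span by blast
  qed
  have "equiv ?A R"
  proof (rule equivI)
    show "R \<subseteq> ?A \<times> ?A" by (auto simp: R_def)
    then have R_dest: "\<exists>p \<in> spans C S. \<exists>q \<in> spans C S. X = span_class C S p \<and> Y = span_class C S q \<and>
        \<phi> p = \<phi> q" if "(X, Y) \<in> R" for X Y
      using that R_iff by (fastforce simp: Arr_Span)
    show "refl_on ?A R" by (rule refl_onI) (auto simp: Arr_Span R_iff)
    show "sym R" by (rule symI) (auto simp: R_def)
    show "trans R"
    proof (rule transI)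
      fix X Y Z assume XY: "(X, Y) \<in> R" and YZ: "(Y, Z) \<in> R"
      \<comment> \<open>\<open>R\<close> quantifies over all representatives, so passing from
        \<open>X\<close> to \<open>Z\<close> takes an actual element of the middle class.\<close>
      obtain q where q: "q \<in> Y" using R_dest[OF XY] self_in_span_class by blast
      show "(X, Z) \<in> R" using XY YZ q unfolding R_def by auto
    qed
  qed
  moreover have "zstar_le C S \<subseteq> R"
  proof (rule subrelI)
    fix X Y assume XY: "(X, Y) \<in> zstar_le C S"
    then obtain p q x where pq: "p \<in> X" "q \<in> Y" "x \<in> S_star C S" "span_mor C x p q"
      by (auto simp: zstar_le_def)
    obtain p' q' where X: "X = span_class C S p'" "p' \<in> spans C S"
      and Y: "Y = span_class C S q'" "q' \<in> spans C S"
      using XY zstar_le_subset by (auto simp: Arr_Span)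
    have "p \<in> spans C S" "q \<in> spans C S"
      using pq X Y by (auto simp: mem_span_class_iff span_iso_def)
    then have "\<phi> p = \<phi> q" using pq by (intro inv) (auto simp: span_le_def)
    then have "\<phi> p' = \<phi> q'" using const pq X Y by simp
    then show "(X, Y) \<in> R" using X Y R_iff by simp
  qed
  ultimately have "zstar_eq C S \<subseteq> R" by (rule zstar_eq_least)
  then show ?thesis using eq R_iff[OF sp] by (auto simp: par_class_eq_iff[OF sp])
qed

lemma mem_par_class:
  assumes "(s, f) \<in> spans C S" "X \<in> par_class C S s f"
  obtains t g where "(t, g) \<in> spans C S" "X = span_class C S (t, g)"
    "par_class C S t g = par_class C S s f"
proof -
  have rel: "(span_class C S (s, f), X) \<in> zstar_eq C S" using assms by (simp add: par_class_def)
  then have "X \<in> Arr (Span C S)" using equiv_zstar_eq by (auto elim: equivE)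
  then obtain t g where tg: "(t, g) \<in> spans C S" "X = span_class C S (t, g)"
    by (auto simp: Arr_Span)
  with rel show thesis using that par_class_eq_iff[OF assms(1) tg(1)] by simp
qed

lemma self_in_par_class: "(s, f) \<in> spans C S \<Longrightarrow> span_class C S (s, f) \<in> par_class C S s f"
  unfolding par_class_def by (rule equiv_class_self[OF equiv_zstar_eq]) (auto simp: Arr_Span)

lemma par_class_Cod:
  assumes "(s, f) \<in> spans C S" "(t, g) \<in> spans C S" "par_class C S s f = par_class C S t g"
  shows "Cod C s = Cod C t" "Cod C f = Cod C g"
proof -
  have "Cod C (fst p) = Cod C (fst q)" "Cod C (snd p) = Cod C (snd q)" if le: "span_le p q" for p q
  proof -
    obtain x where "q \<in> spans C S" "span_mor C x p q" using le by (auto simp: span_le_def)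
    then show "Cod C (fst p) = Cod C (fst q)" "Cod C (snd p) = Cod C (snd q)"
      by (simp_all add: span_mor_Cod[of x p q])
  qed
  from par_class_invariant[where \<phi> = "\<lambda>p. Cod C (fst p)", OF this(1) assms]
    par_class_invariant[where \<phi> = "\<lambda>p. Cod C (snd p)", OF this(2) assms]
  show "Cod C s = Cod C t" "Cod C f = Cod C g" by simp_all
qed

text \<open>A span morphism satisfies an equation for the first legs; used for both legs, it makes
  the same \<open>x\<close> a morphism between the spans with doubled first leg.\<close>

lemma par_class_restriction_cong:
  assumes "(s, f) \<in> spans C S" "(t, g) \<in> spans C S" "par_class C S s f = par_class C S t g"
  shows "par_class C S s s = par_class C S t t"
proof -
  have "par_class C S (fst p) (fst p) = par_class C S (fst q) (fst q)" if "span_le p q" for p q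
  proof (rule par_class_eqI)
    show "span_le (fst p, fst p) (fst q, fst q)"
      using that S_arr by (auto simp: span_le_def span_mor_def spans_def)
  qed
  from par_class_invariant[where \<phi> = "\<lambda>p. par_class C S (fst p) (fst p)", OF this assms]
  show ?thesis by simp
qed

section \<open>Horizontal composition descends to zigzag classes\<close>

lemma comp_span_le_right:
  assumes le: "span_le (s, f) (s1, f1)" and q: "(t, g) \<in> spans C S"
    and pb: "pullback C f t t' f'" and pb1: "pullback C f1 t t1' f1'"
  shows "par_class C S (s \<cdot> t') (g \<cdot> f') = par_class C S (s1 \<cdot> t1') (g \<cdot> f1')"
proof (rule par_class_eqI)
  obtain x where sp: "(s, f) \<in> spans C S" "(s1, f1) \<in> spans C S"
    and x: "x \<in> S_star C S" "span_mor C x (s, f) (s1, f1)"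
    using le by (auto simp: span_le_def)
  obtain x' where x': "pullback C t1' x x' t'" "span_mor C x' (s \<cdot> t', g \<cdot> f') (s1 \<cdot> t1', g \<cdot> f1')"
    by (rule span_mor_comp_right[OF x(2) _ _ _ _ _ _ pb pb1, of g])
      (use sp q S_arr in \<open>auto simp: spans_iff\<close>)
  show "span_le (s \<cdot> t', g \<cdot> f') (s1 \<cdot> t1', g \<cdot> f1')"
    using x' S_star_pullback[OF x(1) x'(1)] comp_span_in_spans[OF sp(1) q pb]
      comp_span_in_spans[OF sp(2) q pb1] by (auto simp: span_le_def)
qed

lemma comp_span_le_left:
  assumes le: "span_le (t, g) (t1, g1)" and p: "(s, f) \<in> spans C S"
    and pb: "pullback C f t t' f'" and pb1: "pullback C f t1 t1' f1'"
  shows "par_class C S (s \<cdot> t') (g \<cdot> f') = par_class C S (s \<cdot> t1') (g1 \<cdot> f1')"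
proof (rule par_class_eqI)
  obtain y where sp: "(t, g) \<in> spans C S" "(t1, g1) \<in> spans C S"
    and y: "y \<in> S_star C S" "span_mor C y (t, g) (t1, g1)"
    using le by (auto simp: span_le_def)
  obtain y' where y': "pullback C f1' y y' f'" "span_mor C y' (s \<cdot> t', g \<cdot> f') (s \<cdot> t1', g1 \<cdot> f1')"
    by (rule span_mor_comp_left[OF y(2) _ _ _ _ _ _ pb pb1, of s])
      (use sp p S_arr in \<open>auto simp: spans_iff\<close>)
  show "span_le (s \<cdot> t', g \<cdot> f') (s \<cdot> t1', g1 \<cdot> f1')"
    using y' S_star_pullback[OF y(1) y'(1)] comp_span_in_spans[OF p sp(1) pb]
      comp_span_in_spans[OF p sp(2) pb1] by (auto simp: span_le_def)
qed

text \<open>Because a pullback is chosen, the composite is not a function of the span alone;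
  \<open>par_class_invariant\<close> is therefore applied to a set-valued \<open>\<phi>\<close>, and
  the given pullbacks are recovered afterwards.\<close>

lemma par_class_comp_right:
  assumes p: "(s, f) \<in> spans C S" "(s1, f1) \<in> spans C S"
    and eq: "par_class C S s f = par_class C S s1 f1" and q: "(t, g) \<in> spans C S"
    and pb: "pullback C f t t' f'" and pb1: "pullback C f1 t t1' f1'"
  shows "par_class C S (s \<cdot> t') (g \<cdot> f') = par_class C S (s1 \<cdot> t1') (g \<cdot> f1')"
proof -
  define \<phi> where "\<phi> p =
    {par_class C S (fst p \<cdot> t') (g \<cdot> f') | t' f'. pullback C (snd p) t t' f'}" for p
  have "\<phi> p = \<phi> p1" if le: "span_le p p1" for p p1
  proof -
    obtain s f s1 f1 where pp: "p = (s, f)" "p1 = (s1, f1)" by (cases p, cases p1)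
    have sp: "(s, f) \<in> spans C S" "(s1, f1) \<in> spans C S" and "Cod C f = Cod C f1"
      using le span_mor_Cod(2) by (auto simp: span_le_def pp)
    \<comment> \<open>Elementwise agreement of the two sets is not enough, as just one of them might
      be empty; pullbacks must be transferred in both directions.\<close>
    have "\<exists>t1' f1'. pullback C f1 t t1' f1'" if "pullback C f t t' f'" for t' f'
      by (rule pullback_of_span[OF q, of f1])
        (use pullbackD(5)[OF that] sp \<open>Cod C f = Cod C f1\<close> in \<open>auto simp: spans_iff\<close>)
    moreover have "\<exists>t' f'. pullback C f t t' f'" if "pullback C f1 t t1' f1'" for t1' f1'
      by (rule pullback_of_span[OF q, of f])
        (use pullbackD(5)[OF that] sp \<open>Cod C f = Cod C f1\<close> in \<open>auto simp: spans_iff\<close>)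
    ultimately show ?thesis unfolding \<phi>_def pp fst_conv snd_conv
      by (rule Collect_eqI_related[OF _ _ comp_span_le_right[OF le[unfolded pp] q]])
  qed
  then have "\<phi> (s, f) = \<phi> (s1, f1)" by (rule par_class_invariant[of \<phi>, OF _ p eq])
  moreover have "par_class C S (s \<cdot> t') (g \<cdot> f') \<in> \<phi> (s, f)"
    using pb unfolding \<phi>_def fst_conv snd_conv by blast
  ultimately have "par_class C S (s \<cdot> t') (g \<cdot> f') \<in> \<phi> (s1, f1)" by simp
  then obtain t2 f2 where pb2: "pullback C f1 t t2 f2"
    "par_class C S (s \<cdot> t') (g \<cdot> f') = par_class C S (s1 \<cdot> t2) (g \<cdot> f2)"
    unfolding \<phi>_def fst_conv snd_conv by blast
  \<comment> \<open>The pullback found in \<open>\<phi>\<close> may differ from the prescribed one.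
    For a reflexive instance of \<open>span_le\<close>, the comparison of composites is independence
    of the chosen pullback.\<close>
  with comp_span_le_right[OF span_le_refl[OF p(2)] q pb2(1) pb1] show ?thesis by simp
qed

text \<open>The mirror image: the second factor varies, so \<open>\<phi>\<close> pulls back along
  its first leg and composes with its second.\<close>

lemma par_class_comp_left:
  assumes q: "(t, g) \<in> spans C S" "(t1, g1) \<in> spans C S"
    and eq: "par_class C S t g = par_class C S t1 g1" and p: "(s, f) \<in> spans C S"
    and pb: "pullback C f t t' f'" and pb1: "pullback C f t1 t1' f1'"
  shows "par_class C S (s \<cdot> t') (g \<cdot> f') = par_class C S (s \<cdot> t1') (g1 \<cdot> f1')"
proof -
  define \<phi> where "\<phi> q =
    {par_class C S (s \<cdot> t') (snd q \<cdot> f') | t' f'. pullback C f (fst q) t' f'}" for q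
  have "\<phi> q = \<phi> q1" if le: "span_le q q1" for q q1
  proof -
    obtain t g t1 g1 where qq: "q = (t, g)" "q1 = (t1, g1)" by (cases q, cases q1)
    have sp: "(t, g) \<in> spans C S" "(t1, g1) \<in> spans C S" and "Cod C t = Cod C t1"
      using le span_mor_Cod(1) by (auto simp: span_le_def qq)
    have "\<exists>t1' f1'. pullback C f t1 t1' f1'" if "pullback C f t t' f'" for t' f'
      by (rule pullback_of_span[OF sp(2), of f])
        (use pullbackD(1,5)[OF that] \<open>Cod C t = Cod C t1\<close> in auto)
    moreover have "\<exists>t' f'. pullback C f t t' f'" if "pullback C f t1 t1' f1'" for t1' f1'
      by (rule pullback_of_span[OF sp(1), of f])
        (use pullbackD(1,5)[OF that] \<open>Cod C t = Cod C t1\<close> in auto)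
    ultimately show ?thesis unfolding \<phi>_def qq fst_conv snd_conv
      by (rule Collect_eqI_related[OF _ _ comp_span_le_left[OF le[unfolded qq] p]])
  qed
  then have "\<phi> (t, g) = \<phi> (t1, g1)" by (rule par_class_invariant[of \<phi>, OF _ q eq])
  moreover have "par_class C S (s \<cdot> t') (g \<cdot> f') \<in> \<phi> (t, g)"
    using pb unfolding \<phi>_def fst_conv snd_conv by blast
  ultimately have "par_class C S (s \<cdot> t') (g \<cdot> f') \<in> \<phi> (t1, g1)" by simp
  then obtain t2 f2 where pb2: "pullback C f t1 t2 f2"
    "par_class C S (s \<cdot> t') (g \<cdot> f') = par_class C S (s \<cdot> t2) (g1 \<cdot> f2)"
    unfolding \<phi>_def fst_conv snd_conv by blast
  with comp_span_le_left[OF span_le_refl[OF q(2)] p pb2(1) pb1] show ?thesis by simp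
qed

section \<open>The category of zigzag classes\<close>

lemma Obj_Par [simp]: "Obj (Par C S) = Obj C"
  by (simp add: Par_def quotient_category_def Span_def)

lemma Id_Par: "Id (Par C S) A = par_class C S (Id C A) (Id C A)"
  by (simp add: Par_def quotient_category_def Span_def par_class_def)

lemma Arr_Par: "X \<in> Arr (Par C S) \<longleftrightarrow> (\<exists>s f. (s, f) \<in> spans C S \<and> X = par_class C S s f)"
  by (auto simp: Par_def quotient_category_def quotient_def Arr_Span par_class_def)

lemma Dom_Par:
  assumes "(s, f) \<in> spans C S"
  shows "Dom (Par C S) (par_class C S s f) = Cod C s"
proof -
  have "Dom (Span C S) X = Cod C s" if "X \<in> par_class C S s f" for X
    by (rule mem_par_class[OF assms that]) (simp add: Dom_Span par_class_Cod(1)[OF _ assms])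
  then have "Dom (Span C S) ` par_class C S s f = {Cod C s}"
    using self_in_par_class[OF assms] by auto
  then show ?thesis by (simp add: Par_def quotient_category_def)
qed

lemma Cod_Par:
  assumes "(s, f) \<in> spans C S"
  shows "Cod (Par C S) (par_class C S s f) = Cod C f"
proof -
  have "Cod (Span C S) X = Cod C f" if "X \<in> par_class C S s f" for X
    by (rule mem_par_class[OF assms that]) (simp add: Cod_Span par_class_Cod(2)[OF _ assms])
  then have "Cod (Span C S) ` par_class C S s f = {Cod C f}"
    using self_in_par_class[OF assms] by auto
  then show ?thesis by (simp add: Par_def quotient_category_def)
qed

lemma Comp_Par:
  assumes p: "(s, f) \<in> spans C S" and q: "(t, g) \<in> spans C S" and pb: "pullback C f t t' f'"
  shows "Comp (Par C S) (par_class C S t g) (par_class C S s f) = par_class C S (s \<cdot> t') (g \<cdot> f')"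
proof -
  have eq: "zstar_eq C S `` {Comp (Span C S) G F} = par_class C S (s \<cdot> t') (g \<cdot> f')"
    if G: "G \<in> par_class C S t g" and F: "F \<in> par_class C S s f" for G F
  proof -
    obtain s1 f1 where 1: "(s1, f1) \<in> spans C S" "F = span_class C S (s1, f1)"
      "par_class C S s1 f1 = par_class C S s f"
      using mem_par_class[OF p F] .
    obtain t1 g1 where 2: "(t1, g1) \<in> spans C S" "G = span_class C S (t1, g1)"
      "par_class C S t1 g1 = par_class C S t g"
      using mem_par_class[OF q G] .
    have f: "f \<in> Arr C" "f1 \<in> Arr C" "Cod C f = Cod C t" "Cod C f1 = Cod C f" "Cod C t1 = Cod C t"
      using p 1 2 q par_class_Cod(2)[OF 1(1) p 1(3)] par_class_Cod(1)[OF 2(1) q 2(3)]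
        pullbackD(5)[OF pb] by (auto simp: spans_iff)
    \<comment> \<open>\<open>pb3\<close> belongs to the composite of the two representatives,
      \<open>pb2\<close> to the mixed one of \<open>(s1, f1)\<close> with \<open>(t, g)\<close>. The
      factors are thus exchanged one at a time.\<close>
    obtain t2 f2 where pb2: "pullback C f1 t t2 f2"
      by (rule pullback_of_span[OF q f(2)]) (use f in auto)
    obtain t3 f3 where pb3: "pullback C f1 t1 t3 f3"
      by (rule pullback_of_span[OF 2(1) f(2)]) (use f in auto)
    have "zstar_eq C S `` {Comp (Span C S) G F} = par_class C S (s1 \<cdot> t3) (g1 \<cdot> f3)"
      by (simp add: 1(2) 2(2) Comp_Span[OF 1(1) 2(1) pb3] par_class_def)
    also have "\<dots> = par_class C S (s1 \<cdot> t2) (g \<cdot> f2)"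
      by (rule par_class_comp_left[OF 2(1) q 2(3) 1(1) pb3 pb2])
    also have "\<dots> = par_class C S (s \<cdot> t') (g \<cdot> f')"
      by (rule par_class_comp_right[OF 1(1) p 1(3) q pb2 pb])
    finally show ?thesis .
  qed
  have "Comp (Par C S) (par_class C S t g) (par_class C S s f) =
      (\<Union>G \<in> par_class C S t g. \<Union>F \<in> par_class C S s f. zstar_eq C S `` {Comp (Span C S) G F})"
    by (simp add: Par_def quotient_category_def)
  also have "\<dots> = par_class C S (s \<cdot> t') (g \<cdot> f')"
    using eq self_in_par_class[OF p] self_in_par_class[OF q] by blast
  finally show ?thesis .
qed

lemma in_hom_Par_iff:
  "X \<in> hom (Par C S) A B \<longleftrightarrow>
    (\<exists>s f. (s, f) \<in> spans C S \<and> Cod C s = A \<and> Cod C f = B \<and> X = par_class C S s f)"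
proof
  assume "X \<in> hom (Par C S) A B"
  then obtain s f where "(s, f) \<in> spans C S" "X = par_class C S s f"
      "Dom (Par C S) X = A" "Cod (Par C S) X = B"
    by (auto simp: hom_def Arr_Par)
  then show "\<exists>s f. (s, f) \<in> spans C S \<and> Cod C s = A \<and> Cod C f = B \<and> X = par_class C S s f"
    using Dom_Par Cod_Par by metis
qed (auto simp: hom_def Arr_Par Dom_Par Cod_Par)

lemma Id_span: "A \<in> Obj C \<Longrightarrow> (Id C A, Id C A) \<in> spans C S"
  by (simp add: spans_iff Id_in_S)

lemma category_Par: "category (Par C S)"
proof
  fix X assume "X \<in> Arr (Par C S)"
  then show "Dom (Par C S) X \<in> Obj (Par C S)" "Cod (Par C S) X \<in> Obj (Par C S)"
    using S_arr by (auto simp: Arr_Par Dom_Par Cod_Par spans_iff)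
next
  fix A assume "A \<in> Obj (Par C S)"
  then show "Id (Par C S) A \<in> hom (Par C S) A A"
    using Id_span[of A] unfolding in_hom_Par_iff Id_Par
    by (intro exI[of _ "Id C A"]) simp
next
  fix X Y A B D assume "X \<in> hom (Par C S) A B" "Y \<in> hom (Par C S) B D"
  then obtain s f t g where X: "(s, f) \<in> spans C S" "Cod C s = A" "X = par_class C S s f"
    and Y: "(t, g) \<in> spans C S" "Cod C g = D" "Y = par_class C S t g" and "Cod C f = Cod C t"
    unfolding in_hom_Par_iff by metis
  moreover have "f \<in> Arr C" using X by (simp add: spans_iff)
  ultimately obtain t' f' where pb: "pullback C f t t' f'" using pullback_of_span by metis
  have "Cod C (s \<cdot> t') = A" "Cod C (g \<cdot> f') = D"
    using X Y pullbackD[OF pb] S_arr by (auto simp: spans_iff)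
  then show "Comp (Par C S) Y X \<in> hom (Par C S) A D"
    unfolding in_hom_Par_iff X(3) Y(3) Comp_Par[OF X(1) Y(1) pb]
    using comp_span_in_spans[OF X(1) Y(1) pb] by blast
next
  fix X A B assume "X \<in> hom (Par C S) A B"
  then obtain s f where X: "(s, f) \<in> spans C S" "Cod C s = A" "Cod C f = B" "X = par_class C S s f"
    unfolding in_hom_Par_iff by metis
  then have sf: "s \<in> Arr C" "f \<in> Arr C" "Dom C s = Dom C f" "A \<in> Obj C" "B \<in> Obj C"
    using S_arr by (auto simp: spans_iff)
  \<comment> \<open>With these pullbacks, composing with an identity returns the pair
    \<open>(s, f)\<close> itself, up to the unit laws of \<open>C\<close>.\<close>
  have pb: "pullback C (Id C A) s s (Id C (Dom C f))" "pullback C f (Id C B) (Id C (Dom C f)) f"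
    using pullback_Id[OF sf(1)] pullback_sym[OF pullback_Id[OF sf(2)]] X(2,3) sf(3) by simp_all
  show "Comp (Par C S) X (Id (Par C S) A) = X"
    using Comp_Par[OF Id_span[OF sf(4)] X(1) pb(1)] sf X(2) by (simp add: Id_Par X(4))
  show "Comp (Par C S) (Id (Par C S) B) X = X"
    using Comp_Par[OF X(1) Id_span[OF sf(5)] pb(2)] sf X(3) by (simp add: Id_Par X(4))
next
  fix X Y Z A B D E
  assume "X \<in> hom (Par C S) A B" "Y \<in> hom (Par C S) B D" "Z \<in> hom (Par C S) D E"
  then obtain s f t g u h where X: "(s, f) \<in> spans C S" "X = par_class C S s f"
    and Y: "(t, g) \<in> spans C S" "Y = par_class C S t g"
    and Z: "(u, h) \<in> spans C S" "Z = par_class C S u h"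
    and cod: "Cod C f = Cod C t" "Cod C g = Cod C u"
    unfolding in_hom_Par_iff by metis
  have arr: "s \<in> Arr C" "f \<in> Arr C" "g \<in> Arr C" "h \<in> Arr C" "t \<in> Arr C"
    "Dom C s = Dom C f" "Dom C t = Dom C g" "Dom C u = Dom C h"
    using X Y Z S_arr by (auto simp: spans_iff)
  obtain t' f' where tf: "pullback C f t t' f'" using pullback_of_span[OF Y(1) arr(2) cod(1)] .
  obtain u' g' where ug: "pullback C g u u' g'" using pullback_of_span[OF Z(1) arr(3) cod(2)] .
  note d = pullbackD[OF tf] pullbackD[OF ug]
  have "u' \<in> S" using S_pullback_closed[OF _ ug] Z(1) by (simp add: spans_iff)
  then obtain v f'' where vf: "pullback C f' u' v f''"
    using S_pullback_exists[of u' f'] d arr by auto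
  note d = d pullbackD[OF vf]
  \<comment> \<open>\<open>tf\<close>, \<open>ug\<close> and \<open>vf\<close> form a pyramid.
    Pasting \<open>vf\<close> to either side yields the pullback for one of the two bracketings; the
    apex is shared, so the resulting spans differ only by associativity in \<open>C\<close>.\<close>
  have outer1: "pullback C f (t \<cdot> u') (t' \<cdot> v) f''" by (rule pullback_paste[OF tf vf])
  have outer2: "pullback C (g \<cdot> f') u v (g' \<cdot> f'')"
    by (rule pullback_sym[OF pullback_paste[OF pullback_sym[OF ug] pullback_sym[OF vf]]])
  have "Comp (Par C S) (Comp (Par C S) Z Y) X = par_class C S (s \<cdot> (t' \<cdot> v)) ((h \<cdot> g') \<cdot> f'')"
    unfolding X(2) Y(2) Z(2) Comp_Par[OF Y(1) Z(1) ug]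
    by (rule Comp_Par[OF X(1) comp_span_in_spans[OF Y(1) Z(1) ug] outer1])
  also have "\<dots> = par_class C S ((s \<cdot> t') \<cdot> v) (h \<cdot> (g' \<cdot> f''))"
    using d arr by (simp add: comp_assoc_arr)
  also have "\<dots> = Comp (Par C S) Z (Comp (Par C S) Y X)"
    unfolding X(2) Y(2) Z(2) Comp_Par[OF X(1) Y(1) tf]
    by (rule Comp_Par[OF comp_span_in_spans[OF X(1) Y(1) tf] Z(1) outer2, symmetric])
  finally show "Comp (Par C S) (Comp (Par C S) Z Y) X = Comp (Par C S) Z (Comp (Par C S) Y X)" .
qed

section \<open>The restriction structure\<close>

text \<open>The section \<open>k\<close> is a span morphism from \<open>(p, q \<cdot> h)\<close> to
  \<open>(p \<cdot> a, q \<cdot> b)\<close>. The outer legs \<open>p\<close> and \<open>q\<close>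
  stay general because (R1), (R4) and the splitting each use different ones.\<close>

lemma par_class_section:
  assumes s: "s \<in> S" and h: "h \<in> Arr C" "Cod C h = Dom C s" and pb: "pullback C (s \<cdot> h) s a b"
    and p: "p \<in> S" "Dom C p = Dom C h" and q: "q \<in> Arr C" "Dom C q = Dom C s"
  shows "par_class C S (p \<cdot> a) (q \<cdot> b) = par_class C S p (q \<cdot> h)"
proof -
  note d = pullbackD[OF pb]
  obtain k where k: "k \<in> S_star C S" "k \<in> Arr C" "Dom C k = Dom C h" "Cod C k = Dom C a"
    "a \<cdot> k = Id C (Dom C h)" "b \<cdot> k = h"
    using section_in_S_star[OF s h pb] .
  have s_arr: "s \<in> Arr C" using s by (rule S_arr)
  have "a \<in> S" by (rule S_pullback_closed[OF s pb])
  then have "p \<cdot> a \<in> S" using p d h s_arr by (intro S_comp) auto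
  moreover have p_arr: "p \<in> Arr C" using p by (simp add: S_arr)
  ultimately have "(p \<cdot> a, q \<cdot> b) \<in> spans C S" "(p, q \<cdot> h) \<in> spans C S"
    using p q d h s_arr by (auto simp: spans_iff)
  moreover have "(p \<cdot> a) \<cdot> k = p" "(q \<cdot> b) \<cdot> k = q \<cdot> h"
    using k p_arr p q d(1-8) h s_arr by (simp_all add: comp_assoc_arr)
  then have "span_mor C k (p, q \<cdot> h) (p \<cdot> a, q \<cdot> b)"
    using k(2-4) p_arr p d h s_arr by (simp add: span_mor_def in_hom_iff)
  ultimately have "span_le (p, q \<cdot> h) (p \<cdot> a, q \<cdot> b)" using k(1) by (auto simp: span_le_def)
  then show ?thesis by (rule par_class_eqI[symmetric])
qed

text \<open>An arrow of \<open>Par\<close> is a set, so its restriction is described through some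
  representing span. On arrows the choice is immaterial by
  \<open>par_class_restriction_cong\<close>; elsewhere the value is arbitrary.\<close>

definition par_rst :: "('m \<times> 'm) set set \<Rightarrow> ('m \<times> 'm) set set" where
  "par_rst X = (SOME Y. \<exists>s f. (s, f) \<in> spans C S \<and> X = par_class C S s f \<and> Y = par_class C S s s)"

lemma par_rst_par_class:
  assumes "(s, f) \<in> spans C S"
  shows "par_rst (par_class C S s f) = par_class C S s s"
proof -
  have "\<exists>s1 f1. (s1, f1) \<in> spans C S \<and> par_class C S s f = par_class C S s1 f1 \<and>
      par_rst (par_class C S s f) = par_class C S s1 s1"
    unfolding par_rst_def by (rule someI_ex) (use assms in blast)
  then show ?thesis using par_class_restriction_cong[OF _ assms] by metis
qed

lemma diag_span: "s \<in> S \<Longrightarrow> (s, s) \<in> spans C S"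
  by (simp add: spans_iff S_arr)

lemma Comp_Par_restriction:
  assumes sf: "(s, f) \<in> spans C S" and tg: "(t, g) \<in> spans C S" and pb: "pullback C s t t' s'"
  shows "Comp (Par C S) (par_class C S t g) (par_rst (par_class C S s f)) =
    par_class C S (s \<cdot> t') (g \<cdot> s')"
  unfolding par_rst_par_class[OF sf]
  by (rule Comp_Par[OF diag_span tg pb]) (use sf in \<open>simp add: spans_iff\<close>)

lemma split_restriction_category_Par: "split_restriction_category (Par C S) par_rst"
proof (intro split_restriction_category.intro restriction_category.intro
    split_restriction_category_axioms.intro restriction_category_axioms.intro category_Par)
  fix X A B assume "X \<in> hom (Par C S) A B"
  then show "par_rst X \<in> hom (Par C S) A A"
    unfolding in_hom_Par_iff using par_rst_par_class diag_span by (metis spans_iff)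
next
  fix X assume "X \<in> Arr (Par C S)"
  then obtain s f where X: "(s, f) \<in> spans C S" "X = par_class C S s f" by (auto simp: Arr_Par)
  then have s: "s \<in> S" "s \<in> Arr C" "f \<in> Arr C" "Dom C f = Dom C s" by (auto simp: spans_iff S_arr)
  then obtain a b where pb: "pullback C s s a b" using S_pullback_exists by blast
  \<comment> \<open>(R1): the composite is \<open>(s \<cdot> a, f \<cdot> b)\<close>; the section
    for an identity \<open>h\<close>, with \<open>p = s\<close> and \<open>q = f\<close>, leads back
    to \<open>(s, f)\<close>.\<close>
  then show "Comp (Par C S) X (par_rst X) = X"
    using Comp_Par_restriction[OF X(1) X(1) pb] s
      par_class_section[OF s(1), of "Id C (Dom C s)" a b s f] by (simp add: X(2))
next
  fix X Y assume "X \<in> Arr (Par C S)" "Y \<in> Arr (Par C S)" "Dom (Par C S) X = Dom (Par C S) Y"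
  then obtain s f t g where X: "(s, f) \<in> spans C S" "X = par_class C S s f"
    and Y: "(t, g) \<in> spans C S" "Y = par_class C S t g" and "Cod C s = Cod C t"
    by (auto simp: Arr_Par Dom_Par)
  have st: "s \<in> S" "s \<in> Arr C" "t \<in> S" using X Y by (auto simp: spans_iff S_arr)
  then obtain t' s' where pb: "pullback C s t t' s'"
    using S_pullback_exists[of t s] \<open>Cod C s = Cod C t\<close> by blast
  note d = pullbackD[OF pb]
  \<comment> \<open>Since \<open>s \<cdot> t' = t \<cdot> s'\<close>, both legs here are the
    diagonal of the pullback square. Interchanging the two restrictions only swaps these equal legs,
    which is (R2).\<close>
  have comp: "Comp (Par C S) (par_rst Y) (par_rst X) = par_class C S (s \<cdot> t') (t \<cdot> s')"
    unfolding X(2) Y(2) par_rst_par_class[OF Y(1)]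
    by (rule Comp_Par_restriction[OF X(1) diag_span[OF st(3)] pb])
  have "Comp (Par C S) (par_rst X) (par_rst Y) = par_class C S (t \<cdot> s') (s \<cdot> t')"
    unfolding X(2) Y(2) par_rst_par_class[OF X(1)]
    by (rule Comp_Par_restriction[OF Y(1) diag_span[OF st(1)] pullback_sym[OF pb]])
  with comp show "Comp (Par C S) (par_rst X) (par_rst Y) = Comp (Par C S) (par_rst Y) (par_rst X)"
    using d(9) by simp
  \<comment> \<open>(R3): restriction keeps only the first leg, which is again that
    diagonal.\<close>
  have "Comp (Par C S) Y (par_rst X) = par_class C S (s \<cdot> t') (g \<cdot> s')"
    unfolding X(2) Y(2) by (rule Comp_Par_restriction[OF X(1) Y(1) pb])
  moreover have "(s \<cdot> t', g \<cdot> s') \<in> spans C S"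
    by (rule comp_span_in_spans[OF diag_span[OF st(1)] Y(1) pb])
  ultimately show "par_rst (Comp (Par C S) Y (par_rst X)) = Comp (Par C S) (par_rst Y) (par_rst X)"
    using comp d(9) by (simp add: par_rst_par_class)
next
  fix X Y assume "X \<in> Arr (Par C S)" "Y \<in> Arr (Par C S)" "Cod (Par C S) X = Dom (Par C S) Y"
  then obtain s f t g where X: "(s, f) \<in> spans C S" "X = par_class C S s f"
    and Y: "(t, g) \<in> spans C S" "Y = par_class C S t g" and cod: "Cod C f = Cod C t"
    by (auto simp: Arr_Par Dom_Par Cod_Par)
  have st: "s \<in> S" "s \<in> Arr C" "t \<in> S" "f \<in> Arr C" "Dom C s = Dom C f"
    using X Y by (auto simp: spans_iff S_arr)
  obtain t' f' where pb: "pullback C f t t' f'" using pullback_of_span[OF Y(1) st(4) cod] .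
  note d = pullbackD[OF pb]
  have gf: "Comp (Par C S) Y X = par_class C S (s \<cdot> t') (g \<cdot> f')" "(s \<cdot> t', g \<cdot> f') \<in> spans C S"
    unfolding X(2) Y(2) using Comp_Par[OF X(1) Y(1) pb] comp_span_in_spans[OF X(1) Y(1) pb] .
  have st': "s \<cdot> t' \<in> S" "s \<cdot> t' \<in> Arr C" using gf(2) S_arr by (auto simp: spans_iff)
  \<comment> \<open>(R4): the restriction of the composite has both legs
    \<open>s \<cdot> t'\<close>. Composing it with \<open>X\<close> pulls \<open>s\<close> back
    along \<open>s \<cdot> t'\<close>, the situation of \<open>par_class_section\<close> with
    \<open>h = t'\<close>.\<close>
  then obtain a b where ab: "pullback C (s \<cdot> t') s a b"
    using S_pullback_exists[of s "s \<cdot> t'"] st d by auto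
  have "Comp (Par C S) X (par_rst (Comp (Par C S) Y X)) = par_class C S ((s \<cdot> t') \<cdot> a) (f \<cdot> b)"
    unfolding gf(1) by (subst X(2)) (rule Comp_Par_restriction[OF gf(2) X(1) ab])
  also have "\<dots> = par_class C S (s \<cdot> t') (f \<cdot> t')"
    by (rule par_class_section[OF st(1) _ _ ab st'(1)]) (use st d in auto)
  \<comment> \<open>The square \<open>f \<cdot> t' = t \<cdot> f'\<close> turns the second leg into
    that of the composite with \<open>(t, t)\<close>.\<close>
  also have "\<dots> = Comp (Par C S) (par_rst Y) X"
    unfolding X(2) Y(2) par_rst_par_class[OF Y(1)] Comp_Par[OF X(1) diag_span[OF st(3)] pb] d(9) ..
  finally show "Comp (Par C S) (par_rst Y) X = Comp (Par C S) X (par_rst (Comp (Par C S) Y X))" ..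
next
  fix E assume "E \<in> Arr (Par C S)" and rst: "par_rst E = E"
  then obtain s f where X: "(s, f) \<in> spans C S" "E = par_class C S s f" by (auto simp: Arr_Par)
  then have s: "s \<in> S" "s \<in> Arr C" by (auto simp: spans_iff S_arr)
  have E: "E = par_class C S s s" using rst X par_rst_par_class by simp
  let ?i = "Id C (Dom C s)"
  have i: "?i \<in> S" using s by (simp add: Id_in_S)
  \<comment> \<open>The idempotent factors through the common domain of its legs:
    \<open>(s, ?i)\<close> is the retraction and \<open>(?i, s)\<close> the section.\<close>
  have sp: "(?i, s) \<in> spans C S" "(s, ?i) \<in> spans C S" using s i by (auto simp: spans_iff)
  have "pullback C ?i ?i ?i ?i" using pullback_iso_square[OF iso_Id, of "Dom C s"] s by simp
  from Comp_Par[OF sp(2,1) this]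
  have mr: "Comp (Par C S) (par_class C S ?i s) (par_class C S s ?i) = E" using s E by simp
  obtain a b where ab: "pullback C s s a b" using S_pullback_exists s by blast
  \<comment> \<open>This order of composition produces the self-pullback \<open>(a, b)\<close> of
    \<open>s\<close>, whose legs need not be invertible when \<open>s\<close> is not monic.
    \<open>par_class_section\<close> with \<open>h\<close>, \<open>p\<close> and \<open>q\<close>
    identities equates its class with that of the identity span.\<close>
  have "Comp (Par C S) (par_class C S s ?i) (par_class C S ?i s) = par_class C S (?i \<cdot> a) (?i \<cdot> b)"
    by (rule Comp_Par[OF sp ab])
  also have "\<dots> = par_class C S ?i (?i \<cdot> ?i)"
    by (rule par_class_section[OF s(1)]) (use s i ab in auto)
  also have "\<dots> = Id (Par C S) (Dom C s)" using s by (simp add: Id_Par)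
  finally have rm: "Comp (Par C S) (par_class C S s ?i) (par_class C S ?i s) =
    Id (Par C S) (Dom C s)" .
  have "par_class C S ?i s \<in> hom (Par C S) (Dom C s) (Cod (Par C S) E)"
    "par_class C S s ?i \<in> hom (Par C S) (Dom (Par C S) E) (Dom C s)"
    using sp s diag_span[OF s(1)]
    by (auto simp: E hom_def Arr_Par Dom_Par Cod_Par)
  then show "splits (Par C S) E"
    unfolding splits_def using mr rm s(2) Dom_in_Obj[of s] by (auto intro!: bexI)
qed

end

theorem theorem4:
  fixes C :: "('o, 'm) precategory" and S :: "'m set"
  assumes "stable_class C S"
  shows "\<exists>rst. split_restriction_category (Par C S) rst \<and>
    (\<forall>(s, f) \<in> spans C S. rst (par_class C S s f) = par_class C S s s)"
proof -
  interpret stable_class C S by (rule assms)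
  show ?thesis using split_restriction_category_Par par_rst_par_class by blast
qed

end
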